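(* Let $\omega=e^{2\pi i/3}$. Every $\mathcal W_2(4,4)$ set is either a cousin of the set $$\{x^2+y^2,\ \omega x^2+\omega^2y^2,\ \omega^2x^2+\omega y^2,\ xy\},$$ which satisfies $(x^2+y^2)^4+(\omega x^2+\omega^2y^2)^4+(\omega^2x^2+\omega y^2)^4=18(xy)^4$, or a sub-cousin of the family of six quadratic forms in $$(x^2+\sqrt3\,xy-y^2)^4-(x^2-\sqrt3\,xy-y^2)^4=(\omega^2x^2+\sqrt3\,xy-\omega y^2)^4-(\omega^2x^2-\sqrt3\,xy-\omega y^2)^4$$ $$=(\omega x^2+\sqrt3\,xy-\omega^2y^2)^4-(\omega x^2-\sqrt3\,xy-\omega^2y^2)^4=8\sqrt3\,xy(x^6-y^6).$$
   Context: A set of nonzero complex binary forms of the same degree is honest if its elements are pairwise non-proportional. A $\mathcal W_2(r,d)$ set is an honest set $\{f_1,\dots,f_r\}$ of complex binary quadratic forms in $x,y$ such that $\{f_1^d,\dots,f_r^d\}$ is linearly dependent over $\mathbb C$. A linear change is an invertible change of variables $M:(x,y)\mapsto(\alpha x+\beta y,\gamma x+\delta y)$ over $\mathbb C$, and $(f\circ M)(x,y)=f(\alpha x+\beta y,\gamma x+\delta y)$. Two sets $\{f_1,\dots,f_r\}$ and $\{g_1,\dots,g_r\}$ are cousins if there are a permutation $\pi\in S_r$, nonzero constants $c_1,\dots,c_r\in\mathbb C$ and a linear change $M$ with $g_j=c_j(f_{\pi(j)}\circ M)$ for all $j$. If six forms satisfy an identity expressing three equal sums of two $d$-th powers (with constants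 $\pm1$ absorbed into the forms), $g_1^d+g_2^d=g_3^d+g_4^d=g_5^d+g_6^d$, then a set of four forms is a sub-cousin of $\{g_1,\dots,g_6\}$ if it is a cousin of the union of two of the three pairs $\{g_1,g_2\},\{g_3,g_4\},\{g_5,g_6\}$. *)

theory Defs
  imports Complex_Main "HOL-Library.Function_Algebras"
begin

text \<open>
  Forms are represented by the polynomial functions they induce on pairs \<open>(x, y)\<close>; since the
  complex numbers are infinite, this identification is injective and compatible with sums,
  products and linear substitutions. Sums, powers and the zero form are the pointwise ones of
  \<^theory>\<open>HOL-Library.Function_Algebras\<close>, and \<open>f \<circ> M\<close> is composition of functions.
\<close>

type_synonym form = "complex \<times> complex \<Rightarrow> complex"

definition binary_form :: "nat \<Rightarrow> form \<Rightarrow> bool" where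
  "binary_form n f \<longleftrightarrow> (\<exists>a. f = (\<lambda>(x, y). \<Sum>i\<le>n. a i * x ^ (n - i) * y ^ i))"

definition qform :: "complex \<Rightarrow> complex \<Rightarrow> complex \<Rightarrow> form" where
  "qform a b c = (\<lambda>(x, y). a * x\<^sup>2 + b * x * y + c * y\<^sup>2)"

definition fscale :: "complex \<Rightarrow> form \<Rightarrow> form" where
  "fscale c f = (\<lambda>v. c * f v)"

interpretation forms: vector_space fscale
  by standard (auto simp: fscale_def fun_eq_iff algebra_simps)

definition proportional :: "form \<Rightarrow> form \<Rightarrow> bool" where
  "proportional f g \<longleftrightarrow> (\<exists>c. c \<noteq> 0 \<and> g = fscale c f)"

definition honest :: "form set \<Rightarrow> bool" where
  "honest S \<longleftrightarrow> (\<exists>n. \<forall>f\<in>S. binary_form n f \<and> f \<noteq> 0) \<and>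
     pairwise (\<lambda>f g. \<not> proportional f g) S"

text \<open>
  For honest sets and \<open>d > 0\<close> the map \<open>f \<mapsto> f ^ d\<close> is injective (equal powers come from
  proportional forms), so dependence of the image set is dependence of the family of powers.
\<close>

definition W2_set :: "nat \<Rightarrow> nat \<Rightarrow> form set \<Rightarrow> bool" where
  "W2_set r d S \<longleftrightarrow> finite S \<and> card S = r \<and> honest S \<and> (\<forall>f\<in>S. binary_form 2 f) \<and>
     forms.dependent ((\<lambda>f. f ^ d) ` S)"

definition linear_change :: "(complex \<times> complex \<Rightarrow> complex \<times> complex) \<Rightarrow> bool" where
  "linear_change M \<longleftrightarrow> (\<exists>\<alpha> \<beta> \<gamma> \<delta>. \<alpha> * \<delta> - \<beta> * \<gamma> \<noteq> 0 \<and>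
     M = (\<lambda>(x, y). (\<alpha> * x + \<beta> * y, \<gamma> * x + \<delta> * y)))"

text \<open>
  The permutation of the indices appears as a bijection \<open>\<pi>\<close> between the two (unindexed) sets.
\<close>

definition cousins :: "form set \<Rightarrow> form set \<Rightarrow> bool" where
  "cousins F G \<longleftrightarrow> (\<exists>\<pi> c M. bij_betw \<pi> G F \<and> linear_change M \<and>
     (\<forall>g\<in>G. c g \<noteq> 0 \<and> g = fscale (c g) (\<pi> g \<circ> M)))"

fun pair_pow_sum :: "nat \<Rightarrow> form \<times> form \<Rightarrow> form" where
  "pair_pow_sum d (f, g) = f ^ d + g ^ d"

fun pair_set :: "form \<times> form \<Rightarrow> form set" where
  "pair_set (f, g) = {f, g}"

definition sub_cousin :: "nat \<Rightarrow> form \<times> form \<Rightarrow> form \<times> form \<Rightarrow> form \<times> form \<Rightarrow> form set \<Rightarrow> bool" where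
  "sub_cousin d p q r S \<longleftrightarrow>
     pair_pow_sum d p = pair_pow_sum d q \<and> pair_pow_sum d q = pair_pow_sum d r \<and>
     finite S \<and> card S = 4 \<and>
     (cousins (pair_set p \<union> pair_set q) S \<or> cousins (pair_set p \<union> pair_set r) S \<or>
      cousins (pair_set q \<union> pair_set r) S)"

definition omega :: complex (\<open>\<omega>\<close>) where
  "\<omega> = exp (2 * of_real pi * \<i> / 3)"

abbreviation sqrt3 :: complex where
  "sqrt3 \<equiv> of_real (sqrt 3)"

text \<open>
  A fourth root of \<open>-1\<close>: \<open>- (f ^ 4) = (fscale \<zeta> f) ^ 4\<close>, which absorbs the minus signs of an
  identity between fourth powers into the forms.
\<close>

definition zeta :: complex (\<open>\<zeta>\<close>) where
  "\<zeta> = cis (pi / 4)"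

end

theory Submission
  imports Defs
begin

text \<open>
  Any four binary quadratic forms satisfy a linear relation, so a dependence
  \<open>f\<^sub>1\<^sup>4 + f\<^sub>2\<^sup>4 + f\<^sub>3\<^sup>4 + f\<^sub>4\<^sup>4 = 0\<close> (constants absorbed) between pairwise non-proportional forms comes
  with a nonzero common member \<open>h\<close> of the pencils spanned by \<open>f\<^sub>1, f\<^sub>2\<close> and by \<open>f\<^sub>3, f\<^sub>4\<close>. A linear change
  turns \<open>h\<close> into \<open>xy\<close> or \<open>y\<^sup>2\<close>. The latter is impossible (\<open>pencils_through_yy\<close>), so \<open>f\<^sub>1\<close> and \<open>f\<^sub>2\<close> are
  combinations of \<open>xy\<close> with some form \<open>\<alpha>x\<^sup>2 + \<gamma>y\<^sup>2\<close>, and \<open>f\<^sub>3\<close> and \<open>f\<^sub>4\<close> of \<open>xy\<close> with some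
  \<open>\<alpha>'x\<^sup>2 + \<gamma>'y\<^sup>2\<close>.

  A binary quartic in \<open>xy\<close> and \<open>\<alpha>x\<^sup>2 + \<gamma>y\<^sup>2\<close> has the coefficients \<open>\<alpha>\<^sup>kC\<^sub>k\<close> and \<open>\<gamma>\<^sup>kC\<^sub>k\<close> at
  \<open>x\<^bsup>4+k\<^esup>y\<^bsup>4-k\<^esup>\<close> and \<open>x\<^bsup>4-k\<^esup>y\<^bsup>4+k\<^esup>\<close>, with the same number \<open>C\<^sub>k\<close>. If the pencils differ, all of
  \<open>\<alpha>\<close>, \<open>\<gamma>\<close>, \<open>\<alpha>'\<close>, \<open>\<gamma>'\<close> are nonzero and \<open>\<rho> = (\<gamma>'/\<alpha>') / (\<gamma>/\<alpha>) \<noteq> 1\<close>. Equating the two octics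
  \<open>f\<^sub>1\<^sup>4 + f\<^sub>2\<^sup>4\<close> and \<open>- f\<^sub>3\<^sup>4 - f\<^sub>4\<^sup>4\<close> then forces \<open>C\<^sub>k = 0\<close> unless \<open>\<rho>\<^sup>k = 1\<close>. As \<open>C\<^sub>3\<close> and \<open>C\<^sub>4\<close> do not both
  vanish, \<open>\<rho>\<close> is a primitive root of unity of order 3, 2 or 4. The conditions on the remaining \<open>C\<^sub>k\<close>,
  together with the fact that both sides are sums of two fourth powers of linear forms in \<open>xy\<close>
  and the other generator, leave three configurations: one for order 3, two for order 2, none for
  order 4 (\<open>pencils_through_xy_normalised\<close>).

  Each configuration is one of two kinds, described without coordinates by quadratic forms \<open>A\<close>, \<open>B\<close>,
  \<open>D\<close> with \<open>AB = D\<^sup>2\<close> (\<open>first_kind\<close>, \<open>second_kind\<close>). Independent forms with \<open>AB = D\<^sup>2\<close> are \<open>x\<^sup>2\<close>, \<open>y\<^sup>2\<close>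
  and \<open>xy\<close> in suitable coordinates (\<open>product_square_normal_form\<close>). In these coordinates the first
  kind is the exceptional quadruple of the theorem, and the second kind is the union of the first two
  pairs of the family of six.

  Two degenerate situations have to be excluded: that some coefficient of the dependence vanishes
  (\<open>three_fourth_powers\<close>), and that the two pencils coincide, where the forms behave like four
  linear forms in two variables (\<open>four_linear_forms\<close>).
\<close>

section \<open>Cube roots of unity and the identity between six fourth powers\<close>

lemma omega_square_sum: "\<omega>\<^sup>2 + \<omega> + 1 = 0"
proof -
  have "\<omega> = cis (2 * pi / 3)"
    by (simp add: omega_def cis_conv_exp mult.commute)
  then have w: "\<omega> = Complex (- 1 / 2) (sqrt 3 / 2)"
    by (simp add: cis.code cos_120 sin_120)
  show ?thesis unfolding w
    by (simp add: complex_eq_iff power2_eq_square)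
qed

lemma omega_cube: "\<omega> ^ 3 = 1" using omega_square_sum by algebra

lemma sqrt3_square: "sqrt3\<^sup>2 = 3"
  by (simp flip: of_real_power)

lemma zeta_power4: "\<zeta> ^ 4 = - 1"
  by (simp add: zeta_def DeMoivre complex_eq_iff)

lemma zeta_nonzero: "\<zeta> \<noteq> 0" by (simp add: zeta_def)

lemma csqrt_csqrt_power4: "csqrt (csqrt c) ^ 4 = c"
proof -
  have "csqrt (csqrt c) ^ 4 = ((csqrt (csqrt c))\<^sup>2)\<^sup>2" by (simp only: power_mult [symmetric]) simp
  then show ?thesis by (simp only: power2_csqrt)
qed

text \<open>
  With \<open>u = px\<^sup>2 - qy\<^sup>2\<close> and \<open>v = sxy\<close> the left-hand side is \<open>8uv(u\<^sup>2 + v\<^sup>2)\<close>, where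
  \<open>u\<^sup>2 + v\<^sup>2 = p\<^sup>2x\<^sup>4 + x\<^sup>2y\<^sup>2 + q\<^sup>2y\<^sup>4\<close> is the cofactor of \<open>u\<close> in \<open>(px\<^sup>2)\<^sup>3 - (qy\<^sup>2)\<^sup>3\<close>.
\<close>

lemma difference_identity:
  fixes p q s x y :: complex
  assumes "p * q = 1" "p ^ 3 = 1" "q ^ 3 = 1" "s\<^sup>2 = 3"
  shows "(p * x\<^sup>2 + s * x * y - q * y\<^sup>2) ^ 4 - (p * x\<^sup>2 - s * x * y - q * y\<^sup>2) ^ 4
    = 8 * s * x * y * (x ^ 6 - y ^ 6)"
  using assms by algebra

section \<open>Quadratic forms\<close>

definition is_quadratic :: "form \<Rightarrow> bool" where
  "is_quadratic f \<longleftrightarrow> (\<exists>a b c. f = qform a b c)"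

lemma qform_apply: "qform a b c (x, y) = a * x\<^sup>2 + b * x * y + c * y\<^sup>2"
  by (simp add: qform_def)

lemma qform_add: "qform a b c + qform a' b' c' = qform (a + a') (b + b') (c + c')"
  by (auto simp: fun_eq_iff qform_def algebra_simps)

lemma qform_diff: "qform a b c - qform a' b' c' = qform (a - a') (b - b') (c - c')"
  by (auto simp: fun_eq_iff qform_def algebra_simps)

lemma fscale_qform: "fscale k (qform a b c) = qform (k * a) (k * b) (k * c)"
  by (auto simp: fun_eq_iff qform_def fscale_def algebra_simps)

lemma qform_eq_0_iff: "qform a b c = 0 \<longleftrightarrow> a = 0 \<and> b = 0 \<and> c = 0"
proof
  assume z: "qform a b c = 0"
  have "qform a b c (1, 0) = 0" "qform a b c (0, 1) = 0" "qform a b c (1, 1) = 0"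
    by (simp_all add: z)
  then show "a = 0 \<and> b = 0 \<and> c = 0" by (simp add: qform_def)
qed (auto simp: fun_eq_iff qform_def)

lemma is_quadratic_fscale: "is_quadratic f \<Longrightarrow> is_quadratic (fscale k f)"
  unfolding is_quadratic_def using fscale_qform by blast

lemma is_quadratic_if_binary_form: "binary_form 2 f \<Longrightarrow> is_quadratic f"
proof -
  assume "binary_form 2 f"
  then obtain a where "f = (\<lambda>(x, y). \<Sum>i\<le>2. a i * x ^ (2 - i) * y ^ i)"
    unfolding binary_form_def by blast
  then have "f = qform (a 0) (a 1) (a 2)"
    by (auto simp: fun_eq_iff qform_def eval_nat_numeral)
  then show ?thesis unfolding is_quadratic_def by blast
qed

lemma power_form_apply [simp]: "(f ^ n) v = f v ^ n" for f :: form
  by (induction n) simp_all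

lemma quartic_eq_0D:
  fixes a0 :: complex
  assumes "\<And>x. a4 * x ^ 4 + a3 * x ^ 3 + a2 * x\<^sup>2 + a1 * x + a0 = 0"
  shows "a4 = 0" "a3 = 0" "a2 = 0" "a1 = 0" "a0 = 0"
proof -
  define e where "e = [a0, a1, a2, a3, a4]"
  have "(\<Sum>i\<le>4. e ! i * x ^ i) = 0" for x
    using assms[of x] by (simp add: e_def eval_nat_numeral algebra_simps)
  then have "\<forall>i\<le>4. e ! i = 0"
    using polyfun_eq_0[of "\<lambda>i. e ! i" 4] by blast
  then have "e ! 4 = 0" "e ! 3 = 0" "e ! 2 = 0" "e ! 1 = 0" "e ! 0 = 0" by auto
  then show "a4 = 0" "a3 = 0" "a2 = 0" "a1 = 0" "a0 = 0"
    by (simp_all add: e_def)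
qed

lemma qform_mult_eq_iff:
  "qform a0 a1 a2 * qform b0 b1 b2 = qform d0 d1 d2 * qform d0 d1 d2 \<longleftrightarrow>
   a0 * b0 = d0\<^sup>2 \<and> a0 * b1 + a1 * b0 = 2 * d0 * d1 \<and> a0 * b2 + a1 * b1 + a2 * b0 = d1\<^sup>2 + 2 * d0 * d2
   \<and> a1 * b2 + a2 * b1 = 2 * d1 * d2 \<and> a2 * b2 = d2\<^sup>2" (is "?L \<longleftrightarrow> ?R")
proof
  assume L: ?L
  have "(a0 * b0 - d0\<^sup>2) * x ^ 4
     + (a0 * b1 + a1 * b0 - 2 * d0 * d1) * x ^ 3
     + (a0 * b2 + a1 * b1 + a2 * b0 - (d1\<^sup>2 + 2 * d0 * d2)) * x\<^sup>2
     + (a1 * b2 + a2 * b1 - 2 * d1 * d2) * x + (a2 * b2 - d2\<^sup>2) = 0" for x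
    using fun_cong[OF L, of "(x, 1)"]
    unfolding times_fun_apply qform_apply power_one mult_1_right by algebra
  from quartic_eq_0D[OF this] show ?R by simp
next
  assume R: ?R
  show ?L
  proof (rule ext, clarify)
    fix x y
    show "(qform a0 a1 a2 * qform b0 b1 b2) (x, y) = (qform d0 d1 d2 * qform d0 d1 d2) (x, y)"
      using R unfolding times_fun_apply qform_apply by algebra
  qed
qed

definition independent_pair :: "form \<Rightarrow> form \<Rightarrow> bool" where
  "independent_pair f g \<longleftrightarrow> (\<forall>c d. fscale c f + fscale d g = 0 \<longrightarrow> c = 0 \<and> d = 0)"

lemma independent_qform_iff:
  "independent_pair (qform a b c) (qform a' b' c') \<longleftrightarrow>
     a * b' \<noteq> a' * b \<or> a * c' \<noteq> a' * c \<or> b * c' \<noteq> b' * c"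
proof -
  have "(\<forall>k l. k * a + l * a' = 0 \<and> k * b + l * b' = 0 \<and> k * c + l * c' = 0 \<longrightarrow> k = 0 \<and> l = 0) \<longleftrightarrow>
     a * b' \<noteq> a' * b \<or> a * c' \<noteq> a' * c \<or> b * c' \<noteq> b' * c" (is "?L \<longleftrightarrow> ?R")
  proof
    assume L: ?L
    show ?R
    proof (rule ccontr)
      assume n: "\<not> ?R"
      then have "a = 0" using L[rule_format, of "a'" "- a"] by (simp add: algebra_simps)
      moreover have "b = 0" using n L[rule_format, of "b'" "- b"] by (simp add: algebra_simps)
      moreover have "c = 0" using n L[rule_format, of "c'" "- c"] by (simp add: algebra_simps)
      ultimately show False using L[rule_format, of 1 0] by simp
    qed
  next
    assume R: ?R
    show ?L
    proof (intro allI impI)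
      fix k l assume h: "k * a + l * a' = 0 \<and> k * b + l * b' = 0 \<and> k * c + l * c' = 0"
      have "k * (a * b' - a' * b) = 0" "k * (a * c' - a' * c) = 0" "k * (b * c' - b' * c) = 0"
         "l * (a * b' - a' * b) = 0" "l * (a * c' - a' * c) = 0" "l * (b * c' - b' * c) = 0"
        using h by algebra+
      then show "k = 0 \<and> l = 0" using R by auto
    qed
  qed
  then show ?thesis
    unfolding independent_pair_def fscale_qform qform_add qform_eq_0_iff .
qed

lemma independent_nonzero:
  assumes "independent_pair f g" shows "f \<noteq> 0" "g \<noteq> 0"
proof -
  show "f \<noteq> 0"
  proof
    assume "f = 0"
    then have "fscale 1 f + fscale 0 g = 0" by (auto simp: fscale_def fun_eq_iff)
    then show False using assms[unfolded independent_pair_def, rule_format, of 1 0] by simp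
  qed
  show "g \<noteq> 0"
  proof
    assume "g = 0"
    then have "fscale 0 f + fscale 1 g = 0" by (auto simp: fscale_def fun_eq_iff)
    then show False using assms[unfolded independent_pair_def, rule_format, of 0 1] by simp
  qed
qed

lemma nonproportional_independent:
  assumes "\<not> proportional f g" "f \<noteq> 0" "g \<noteq> 0"
  shows "independent_pair f g"
  unfolding independent_pair_def
proof (intro allI impI)
  fix c d assume h: "fscale c f + fscale d g = 0"
  have hv: "c * f v + d * g v = 0" for v using fun_cong[OF h, of v] by (simp add: fscale_def)
  have "d = 0"
  proof (rule ccontr)
    assume d: "d \<noteq> 0"
    have g: "g = fscale (- c / d) f"
    proof
      fix v show "g v = fscale (- c / d) f v"
        using hv[of v] d by (simp add: fscale_def field_simps eq_neg_iff_add_eq_0)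
    qed
    have "c \<noteq> 0" using g assms(3) by (auto simp: fscale_def fun_eq_iff)
    then show False using g assms(1) d unfolding proportional_def
      by (metis divide_eq_0_iff neg_equal_0_iff_equal)
  qed
  moreover from this have "c = 0" using hv assms(2) by (auto simp: fun_eq_iff)
  ultimately show "c = 0 \<and> d = 0" by simp
qed

section \<open>Linear changes and normal forms\<close>

lemma linear_changeI:
  "a * d - b * c \<noteq> 0 \<Longrightarrow> linear_change (\<lambda>(x, y). (a * x + b * y, c * x + d * y))"
  unfolding linear_change_def by blast

lemma linear_change_inverse:
  assumes "linear_change M"
  shows "\<exists>N. linear_change N \<and> M \<circ> N = id \<and> N \<circ> M = id"
proof -
  obtain a b c d where det: "a * d - b * c \<noteq> 0"
    and M: "M = (\<lambda>(x, y). (a * x + b * y, c * x + d * y))"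
    using assms unfolding linear_change_def by blast
  define e where "e = 1 / (a * d - b * c)"
  have e: "e * (a * d - b * c) = 1" using det by (simp add: e_def)
  define N where "N = (\<lambda>(x, y). (d * e * x + - b * e * y, - c * e * x + a * e * y))"
  have "d * e * (a * e) - - b * e * (- c * e) = e" using e by algebra
  moreover have "e \<noteq> 0" using e by auto
  ultimately have "linear_change N"
    unfolding linear_change_def N_def by metis
  moreover have "M \<circ> N = id"
  proof (rule ext, clarify)
    fix x y
    have "a * (d * e * x + - b * e * y) + b * (- c * e * x + a * e * y) = x"
      "c * (d * e * x + - b * e * y) + d * (- c * e * x + a * e * y) = y"
      using e by algebra+
    then show "(M \<circ> N) (x, y) = id (x, y)" by (simp add: M N_def)
  qed
  moreover have "N \<circ> M = id"
  proof (rule ext, clarify)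
    fix x y
    have "d * e * (a * x + b * y) + - b * e * (c * x + d * y) = x"
      "- c * e * (a * x + b * y) + a * e * (c * x + d * y) = y"
      using e by algebra+
    then show "(N \<circ> M) (x, y) = id (x, y)" by (simp add: M N_def)
  qed
  ultimately show ?thesis by blast
qed

lemma linear_change_comp:
  assumes "linear_change M" "linear_change N"
  shows "linear_change (M \<circ> N)"
proof -
  obtain a b c d where M: "a * d - b * c \<noteq> 0" "M = (\<lambda>(x, y). (a * x + b * y, c * x + d * y))"
    using assms(1) unfolding linear_change_def by blast
  obtain a' b' c' d' where N: "a' * d' - b' * c' \<noteq> 0" "N = (\<lambda>(x, y). (a' * x + b' * y, c' * x + d' * y))"
    using assms(2) unfolding linear_change_def by blast
  have "(a * a' + b * c') * (c * b' + d * d') - (a * b' + b * d') * (c * a' + d * c')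
     = (a * d - b * c) * (a' * d' - b' * c')"
    by (simp add: algebra_simps)
  then have det: "(a * a' + b * c') * (c * b' + d * d') - (a * b' + b * d') * (c * a' + d * c') \<noteq> 0"
    using M(1) N(1) by simp
  have MN: "M \<circ> N = (\<lambda>(x, y). ((a * a' + b * c') * x + (a * b' + b * d') * y,
      (c * a' + d * c') * x + (c * b' + d * d') * y))"
    by (auto simp: M N fun_eq_iff algebra_simps)
  show ?thesis unfolding MN by (rule linear_changeI[OF det])
qed

lemma is_quadratic_comp:
  assumes "is_quadratic f" "linear_change M"
  shows "is_quadratic (f \<circ> M)"
proof -
  obtain a b c where f: "f = qform a b c" using assms(1) unfolding is_quadratic_def by blast
  obtain p q r s where M: "M = (\<lambda>(x, y). (p * x + q * y, r * x + s * y))"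
    using assms(2) unfolding linear_change_def by blast
  have "f \<circ> M = qform (a * p\<^sup>2 + b * p * r + c * r\<^sup>2) (2 * a * p * q + b * (p * s + q * r) + 2 * c * r * s)
     (a * q\<^sup>2 + b * q * s + c * s\<^sup>2)"
    by (auto simp: f M fun_eq_iff qform_apply algebra_simps power2_eq_square)
  then show ?thesis unfolding is_quadratic_def by blast
qed

lemma independent_comp:
  assumes "independent_pair f g" "linear_change M"
  shows "independent_pair (f \<circ> M) (g \<circ> M)"
proof -
  obtain N where N: "M \<circ> N = id" using linear_change_inverse[OF assms(2)] by blast
  show ?thesis unfolding independent_pair_def
  proof (intro allI impI)
    fix c d assume h: "fscale c (f \<circ> M) + fscale d (g \<circ> M) = 0"
    have "fscale c f + fscale d g = 0"
    proof
      fix v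
      show "(fscale c f + fscale d g) v = 0 v"
        using fun_cong[OF h, of "N v"] pointfree_idE[OF N, of v] by (simp add: fscale_def)
    qed
    then show "c = 0 \<and> d = 0" using assms(1) unfolding independent_pair_def by blast
  qed
qed

lemma quadratic_normal_form:
  assumes "is_quadratic f" "f \<noteq> 0"
  shows "\<exists>L. linear_change L \<and> (f = qform 0 1 0 \<circ> L \<or> f = qform 0 0 1 \<circ> L)"
proof -
  obtain a b c where f: "f = qform a b c" using assms(1) unfolding is_quadratic_def by blast
  have nz: "a \<noteq> 0 \<or> b \<noteq> 0 \<or> c \<noteq> 0" using assms(2) unfolding f qform_eq_0_iff by blast
  consider (1) "a = 0" "b = 0" "c \<noteq> 0" | (2) "a = 0" "b \<noteq> 0" | (3) "a \<noteq> 0" using nz by blast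
  then show ?thesis
  proof cases
    case 1
    have "f = qform 0 0 1 \<circ> (\<lambda>(x, y). (1 * x + 0 * y, 0 * x + csqrt c * y))"
      by (auto simp: f fun_eq_iff qform_apply 1 power_mult_distrib)
    then show ?thesis using linear_changeI[of 1 "csqrt c" 0 0] 1(3) by auto
  next
    case 2
    have "f = qform 0 1 0 \<circ> (\<lambda>(x, y). (b * x + c * y, 0 * x + 1 * y))"
      by (auto simp: f fun_eq_iff qform_apply 2 power2_eq_square algebra_simps)
    then show ?thesis using linear_changeI[of b 1 c 0] 2(2) by auto
  next
    case 3
    define d where "d = csqrt (b\<^sup>2 - 4 * a * c)"
    have d: "d\<^sup>2 = b\<^sup>2 - 4 * a * c" by (simp add: d_def)
    define r s where "r = (- b + d) / (2 * a)" and "s = (- b - d) / (2 * a)"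
    have rs: "2 * a * r = - b + d" "2 * a * s = - b - d" using 3 by (simp_all add: r_def s_def)
    have "4 * a * (a * (r * s) - c) = 0" "2 * (a * (r + s) + b) = 0" using rs d by algebra+
    then have "a * (r * s) - c = 0" "a * (r + s) + b = 0"
      using 3 unfolding mult_eq_0_iff by simp_all
    then have sym: "c = a * (r * s)" "b = - a * (r + s)" by algebra+
    show ?thesis
    proof (cases "r = s")
      case False
      have "f = qform 0 1 0 \<circ> (\<lambda>(x, y). (a * x + (- a * r) * y, 1 * x + (- s) * y))"
        by (auto simp: f fun_eq_iff qform_apply sym power2_eq_square algebra_simps)
      moreover have "a * (- s) - - a * r * 1 \<noteq> 0" using False 3 by simp
      ultimately show ?thesis using linear_changeI[of a "- s" "- a * r" 1] by blast
    next
      case True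
      define q where "q = csqrt a"
      have q: "q\<^sup>2 = a" "q \<noteq> 0" using 3 by (simp_all add: q_def)
      have "f = qform 0 0 1 \<circ> (\<lambda>(x, y). (0 * x + 1 * y, q * x + (- q * r) * y))"
      proof (rule ext, clarify)
        fix x y
        show "f (x, y) = (qform 0 0 1 \<circ> (\<lambda>(x, y). (0 * x + 1 * y, q * x + (- q * r) * y))) (x, y)"
          using q(1)[symmetric]
          by (simp add: f qform_apply sym True[symmetric] power2_eq_square algebra_simps)
      qed
      moreover have "0 * (- q * r) - 1 * q \<noteq> 0" using q(2) by simp
      ultimately show ?thesis using linear_changeI[of 0 "- q * r" 1 q] by blast
    qed
  qed
qed

lemma times_comp: "(f \<circ> M) * (g \<circ> M) = (f * g) \<circ> M" for f g :: form
  by (simp add: fun_eq_iff)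

text \<open>
  In coordinates where \<open>A\<close> is \<open>xy\<close>, both outer coefficients of \<open>D\<close> vanish and \<open>B\<close> is a multiple of
  \<open>A\<close>. So \<open>A\<close> is the square of a linear form \<open>y\<close>, which then divides \<open>D = y\<ell>\<close> and leaves
  \<open>B = \<ell>\<^sup>2\<close>; the new coordinates are \<open>y\<close> and \<open>\<ell>\<close>.
\<close>

lemma product_square_normal_form:
  assumes "is_quadratic A" "is_quadratic B" "is_quadratic D" "independent_pair A B" "A * B = D * D"
  shows "\<exists>L. linear_change L \<and> A = qform 1 0 0 \<circ> L \<and> B = qform 0 0 1 \<circ> L \<and> D = qform 0 1 0 \<circ> L"
proof -
  obtain L where L: "linear_change L" "A = qform 0 1 0 \<circ> L \<or> A = qform 0 0 1 \<circ> L"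
    using quadratic_normal_form[OF assms(1)] independent_nonzero[OF assms(4)] by blast
  obtain N where N: "linear_change N" "L \<circ> N = id" "N \<circ> L = id"
    using linear_change_inverse[OF L(1)] by blast
  have NL: "f \<circ> N \<circ> L = f" for f :: form by (simp add: comp_assoc N(3))
  have LN: "f \<circ> L \<circ> N = f" for f :: form by (simp add: comp_assoc N(2))
  obtain b0 b1 b2 where B: "B \<circ> N = qform b0 b1 b2"
    using is_quadratic_comp[OF assms(2) N(1)] unfolding is_quadratic_def by blast
  obtain d0 d1 d2 where D: "D \<circ> N = qform d0 d1 d2"
    using is_quadratic_comp[OF assms(3) N(1)] unfolding is_quadratic_def by blast
  have prod: "(A \<circ> N) * qform b0 b1 b2 = qform d0 d1 d2 * qform d0 d1 d2"
    unfolding B[symmetric] D[symmetric] using assms(5) by (metis times_comp)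
  have ind: "independent_pair (A \<circ> N) (qform b0 b1 b2)"
    using independent_comp[OF assms(4) N(1)] unfolding B .
  have "A \<circ> N \<noteq> qform 0 1 0"
  proof
    assume A: "A \<circ> N = qform 0 1 0"
    show False using prod ind unfolding A qform_mult_eq_iff independent_qform_iff by auto
  qed
  then have LA: "A = qform 0 0 1 \<circ> L" and A: "A \<circ> N = qform 0 0 1" using L(2) LN by auto
  have c: "d0 = 0" "b0 = d1\<^sup>2" "b1 = 2 * d1 * d2" "b2 = d2\<^sup>2"
    using prod unfolding A qform_mult_eq_iff by auto
  have d1: "d1 \<noteq> 0" using ind unfolding A independent_qform_iff c by auto
  define K where "K = (\<lambda>(x, y). (0 * x + 1 * y :: complex, d1 * x + d2 * y))"
  have K: "linear_change K" unfolding K_def by (rule linear_changeI) (use d1 in simp)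
  have "A \<circ> N = qform 1 0 0 \<circ> K" "B \<circ> N = qform 0 0 1 \<circ> K" "D \<circ> N = qform 0 1 0 \<circ> K"
    unfolding A B D c K_def by (auto simp: fun_eq_iff qform_apply power2_eq_square algebra_simps)
  then have "A = qform 1 0 0 \<circ> (K \<circ> L)" "B = qform 0 0 1 \<circ> (K \<circ> L)" "D = qform 0 1 0 \<circ> (K \<circ> L)"
    by (metis NL comp_assoc)+
  then show ?thesis using linear_change_comp[OF K L(1)] by blast
qed

section \<open>The two kinds of quadruples\<close>

text \<open>
  Two sets of pairwise non-proportional forms of the same size are matched projectively as soon as
  each form of \<open>S\<close> is a multiple of some form in \<open>F\<close>. This avoids carrying permutations and scaling
  constants through the classification.
\<close>

definition covered :: "form set \<Rightarrow> form set \<Rightarrow> bool" where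
  "covered F S \<longleftrightarrow> (\<forall>f\<in>S. \<exists>g\<in>F. proportional g f)"

lemma covered_insert [simp]:
  "covered F (insert f S) \<longleftrightarrow> (\<exists>g\<in>F. proportional g f) \<and> covered F S"
  by (auto simp: covered_def)

lemma covered_empty [simp]: "covered F {}"
  by (simp add: covered_def)

lemma proportionalI: "k \<noteq> 0 \<Longrightarrow> g = fscale k f \<Longrightarrow> proportional f g"
  by (auto simp: proportional_def)

lemma proportional_sym:
  assumes "proportional f g" shows "proportional g f"
proof -
  obtain c where c: "c \<noteq> 0" "g = fscale c f" using assms unfolding proportional_def by blast
  then have "f = fscale (1 / c) g" by (simp add: fscale_def)
  then show ?thesis using c(1) by (intro proportionalI[of "1 / c"]) auto
qed

lemma proportional_trans: "proportional f g \<Longrightarrow> proportional g h \<Longrightarrow> proportional f h"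
proof -
  assume "proportional f g" "proportional g h"
  then obtain c d where "c \<noteq> 0" "d \<noteq> 0" "g = fscale c f" "h = fscale d g"
    unfolding proportional_def by blast
  then show ?thesis
    by (intro proportionalI[of "d * c"]) (auto simp: fscale_def mult.assoc)
qed

lemma covered_trans: "covered F G \<Longrightarrow> covered G S \<Longrightarrow> covered F S"
  unfolding covered_def using proportional_trans by meson

lemma covered_comp:
  assumes "covered F S" shows "covered ((\<lambda>f. f \<circ> M) ` F) ((\<lambda>f. f \<circ> M) ` S)"
proof -
  have "proportional (f \<circ> M) (g \<circ> M)" if "proportional f g" for f g
    using that unfolding proportional_def fscale_def comp_def by auto
  then show ?thesis using assms unfolding covered_def ball_simps bex_simps by meson
qed

text \<open>
  For \<open>A = x\<^sup>2\<close>, \<open>B = y\<^sup>2\<close> and \<open>D = xy\<close> these are the four forms in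
  \<open>(x\<^sup>2 + y\<^sup>2)\<^sup>4 + (\<omega>x\<^sup>2 + \<omega>\<^sup>2y\<^sup>2)\<^sup>4 + (\<omega>\<^sup>2x\<^sup>2 + \<omega>y\<^sup>2)\<^sup>4 = 18(xy)\<^sup>4\<close>.
\<close>

definition first_kind :: "form set \<Rightarrow> bool" where
  "first_kind S \<longleftrightarrow> (\<exists>A B D. is_quadratic A \<and> is_quadratic B \<and> is_quadratic D \<and>
     independent_pair A B \<and> A * B = D * D \<and>
     covered {A + B, fscale \<omega> A + fscale (\<omega>\<^sup>2) B, fscale (\<omega>\<^sup>2) A + fscale \<omega> B, D} S)"

text \<open>
  For \<open>A = x\<^sup>2\<close>, \<open>B = y\<^sup>2\<close> and \<open>D = xy\<close> these are the first two pairs of the six forms. The other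
  choices of two pairs are equivalent, since \<open>(x, y) \<mapsto> (\<omega>\<^sup>2x, \<omega>y)\<close> permutes the three pairs cyclically.
\<close>

definition second_kind :: "form set \<Rightarrow> bool" where
  "second_kind S \<longleftrightarrow> (\<exists>A B D. is_quadratic A \<and> is_quadratic B \<and> is_quadratic D \<and>
     independent_pair A B \<and> A * B = D * D \<and>
     covered {A + fscale sqrt3 D - B, A - fscale sqrt3 D - B,
       fscale (\<omega>\<^sup>2) A + fscale sqrt3 D - fscale \<omega> B,
       fscale (\<omega>\<^sup>2) A - fscale sqrt3 D - fscale \<omega> B} S)"

text \<open>
  The symmetric description of the second kind: \<open>(W + V)\<^sup>4 - (W - V)\<^sup>4 = (U + V)\<^sup>4 - (U - V)\<^sup>4\<close> says
  \<open>WV(W\<^sup>2 + V\<^sup>2) = UV(U\<^sup>2 + V\<^sup>2)\<close>, which for \<open>U \<noteq> W\<close> and \<open>V \<noteq> 0\<close> is the conic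
  \<open>U\<^sup>2 + UW + W\<^sup>2 + V\<^sup>2 = 0\<close>. It factors as \<open>(U - \<omega>W)(U - \<omega>\<^sup>2W) = - V\<^sup>2\<close>, whence \<open>A\<close>, \<open>B\<close> and \<open>D\<close>.
\<close>

lemma second_kind_if_conic:
  assumes q: "is_quadratic U" "is_quadratic V" "is_quadratic W"
    and ind: "independent_pair U W"
    and conic: "\<And>v. (U v)\<^sup>2 + U v * W v + (W v)\<^sup>2 + (V v)\<^sup>2 = 0"
    and cov: "covered {W + V, W - V, U + V, U - V} S"
  shows "second_kind S"
proof -
  \<comment> \<open>The factor is chosen so that \<open>A - B = W\<close> and \<open>\<omega>\<^sup>2A - \<omega>B = U\<close> below. As \<open>\<tau>\<^sup>2 = - 1/3\<close>, the
    product \<open>AB\<close> is \<open>V\<^sup>2/3\<close>.\<close>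
  define \<tau> where "\<tau> = 1 / (\<omega>\<^sup>2 - \<omega>)"
  have "(\<omega>\<^sup>2 - \<omega>)\<^sup>2 = - 3" using omega_square_sum by algebra
  then have "\<omega>\<^sup>2 - \<omega> \<noteq> 0" by auto
  then have t1: "\<tau> * (\<omega>\<^sup>2 - \<omega>) = 1" by (simp add: \<tau>_def)
  define k where "k = 1 / sqrt3"
  have k: "k * sqrt3 = 1" by (simp add: k_def)
  obtain u0 u1 u2 where U: "U = qform u0 u1 u2" using q by (auto simp: is_quadratic_def)
  obtain w0 w1 w2 where W: "W = qform w0 w1 w2" using q by (auto simp: is_quadratic_def)
  obtain v0 v1 v2 where V: "V = qform v0 v1 v2" using q by (auto simp: is_quadratic_def)
  define A where "A = fscale \<tau> (U - fscale \<omega> W)"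
  define B where "B = fscale \<tau> (U - fscale (\<omega>\<^sup>2) W)"
  define D where "D = fscale k V"
  have W': "W = A - B"
    using t1 unfolding A_def B_def fun_eq_iff fscale_def minus_apply plus_fun_apply by algebra
  have U': "U = fscale (\<omega>\<^sup>2) A - fscale \<omega> B"
    using t1 unfolding A_def B_def fun_eq_iff fscale_def minus_apply plus_fun_apply by algebra
  have V': "V = fscale sqrt3 D"
    using k by (simp add: D_def fun_eq_iff fscale_def algebra_simps)
  have t2: "\<tau>\<^sup>2 * 3 = - 1" using t1 omega_square_sum by algebra
  have k2: "k\<^sup>2 * 3 = 1" using k sqrt3_square by algebra
  have AB: "A * B = D * D"
  proof
    fix v
    have "\<tau>\<^sup>2 * ((U v)\<^sup>2 + U v * W v + (W v)\<^sup>2) = k\<^sup>2 * (V v)\<^sup>2"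
      using conic[of v] t2 k2 by algebra
    then show "(A * B) v = (D * D) v"
      using omega_square_sum
      unfolding A_def B_def D_def fscale_def minus_apply times_fun_apply by algebra
  qed
  have "independent_pair A B"
    unfolding independent_pair_def
  proof (intro allI impI)
    fix c d assume "fscale c A + fscale d B = 0"
    then have "fscale (\<tau> * (c + d)) U + fscale (- \<tau> * (c * \<omega> + d * \<omega>\<^sup>2)) W = 0"
      by (auto simp: fun_eq_iff A_def B_def fscale_def algebra_simps)
    then have "\<tau> * (c + d) = 0" "- \<tau> * (c * \<omega> + d * \<omega>\<^sup>2) = 0"
      using ind unfolding independent_pair_def by blast+
    then show "c = 0 \<and> d = 0" using t1 t2 by algebra
  qed
  moreover have "is_quadratic A" "is_quadratic B" "is_quadratic D"
    unfolding is_quadratic_def A_def B_def D_def U V W fscale_qform qform_diff by blast+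
  moreover have "covered {A + fscale sqrt3 D - B, A - fscale sqrt3 D - B,
       fscale (\<omega>\<^sup>2) A + fscale sqrt3 D - fscale \<omega> B,
       fscale (\<omega>\<^sup>2) A - fscale sqrt3 D - fscale \<omega> B} S"
    using cov unfolding U' V' W' by (simp add: algebra_simps)
  ultimately show ?thesis using AB unfolding second_kind_def by blast
qed

lemma first_kind_comp:
  assumes "first_kind S" "linear_change M" shows "first_kind ((\<lambda>f. f \<circ> M) ` S)"
proof -
  obtain A B D where h: "is_quadratic A" "is_quadratic B" "is_quadratic D"
     "independent_pair A B" "A * B = D * D"
     "covered {A + B, fscale \<omega> A + fscale (\<omega>\<^sup>2) B, fscale (\<omega>\<^sup>2) A + fscale \<omega> B, D} S"
    using assms(1) unfolding first_kind_def by blast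
  have "(A \<circ> M) * (B \<circ> M) = (D \<circ> M) * (D \<circ> M)" using h(5) by (metis times_comp)
  moreover have "covered {(A \<circ> M) + (B \<circ> M), fscale \<omega> (A \<circ> M) + fscale (\<omega>\<^sup>2) (B \<circ> M),
      fscale (\<omega>\<^sup>2) (A \<circ> M) + fscale \<omega> (B \<circ> M), D \<circ> M} ((\<lambda>f. f \<circ> M) ` S)"
    using covered_comp[OF h(6), of M] by (simp add: comp_def fscale_def plus_fun_def)
  ultimately show ?thesis
    unfolding first_kind_def
    using is_quadratic_comp[OF h(1) assms(2)] is_quadratic_comp[OF h(2) assms(2)]
      is_quadratic_comp[OF h(3) assms(2)] independent_comp[OF h(4) assms(2)] by blast
qed

lemma second_kind_comp:
  assumes "second_kind S" "linear_change M" shows "second_kind ((\<lambda>f. f \<circ> M) ` S)"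
proof -
  obtain A B D where h: "is_quadratic A" "is_quadratic B" "is_quadratic D"
     "independent_pair A B" "A * B = D * D"
     "covered {A + fscale sqrt3 D - B, A - fscale sqrt3 D - B,
       fscale (\<omega>\<^sup>2) A + fscale sqrt3 D - fscale \<omega> B,
       fscale (\<omega>\<^sup>2) A - fscale sqrt3 D - fscale \<omega> B} S"
    using assms(1) unfolding second_kind_def by blast
  have "(A \<circ> M) * (B \<circ> M) = (D \<circ> M) * (D \<circ> M)" using h(5) by (metis times_comp)
  moreover have "covered {(A \<circ> M) + fscale sqrt3 (D \<circ> M) - (B \<circ> M), (A \<circ> M) - fscale sqrt3 (D \<circ> M) - (B \<circ> M),
       fscale (\<omega>\<^sup>2) (A \<circ> M) + fscale sqrt3 (D \<circ> M) - fscale \<omega> (B \<circ> M),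
       fscale (\<omega>\<^sup>2) (A \<circ> M) - fscale sqrt3 (D \<circ> M) - fscale \<omega> (B \<circ> M)} ((\<lambda>f. f \<circ> M) ` S)"
    using covered_comp[OF h(6), of M] by (simp add: comp_def fscale_def plus_fun_def fun_diff_def)
  ultimately show ?thesis
    unfolding second_kind_def
    using is_quadratic_comp[OF h(1) assms(2)] is_quadratic_comp[OF h(2) assms(2)]
      is_quadratic_comp[OF h(3) assms(2)] independent_comp[OF h(4) assms(2)] by blast
qed

text \<open>
  The map that sends each element of \<open>S\<close> to a form that covers it is injective because \<open>S\<close> is pairwise
  non-proportional, hence bijective by counting.
\<close>

lemma cousinsI:
  assumes "finite F" "card F \<le> card S" "finite S"
    and S: "pairwise (\<lambda>f g. \<not> proportional f g) S"
    and M: "linear_change M" and cov: "covered ((\<lambda>f. f \<circ> M) ` F) S"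
  shows "cousins F S"
proof -
  have "\<forall>g\<in>S. \<exists>f c. f \<in> F \<and> c \<noteq> 0 \<and> g = fscale c (f \<circ> M)"
    using cov unfolding covered_def proportional_def bex_simps by blast
  then obtain p c where p: "\<And>g. g \<in> S \<Longrightarrow> p g \<in> F \<and> c g \<noteq> 0 \<and> g = fscale (c g) (p g \<circ> M)"
    by metis
  have "inj_on p S"
  proof (rule inj_onI, rule ccontr)
    fix g h assume gh: "g \<in> S" "h \<in> S" "p g = p h" "g \<noteq> h"
    have "proportional (p g \<circ> M) g" "proportional (p g \<circ> M) h"
      using p[OF gh(1)] p[OF gh(2)] gh(3) unfolding proportional_def by auto
    then have "proportional g h" using proportional_sym proportional_trans by blast
    then show False using S gh unfolding pairwise_def by blast
  qed
  moreover have "p ` S = F"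
  proof (rule card_seteq[OF assms(1)])
    show "p ` S \<subseteq> F" using p by blast
    show "card F \<le> card (p ` S)" using assms(2) calculation by (simp add: card_image)
  qed
  ultimately have "bij_betw p S F" unfolding bij_betw_def by blast
  then show ?thesis unfolding cousins_def using M p by blast
qed

lemma first_kind_cousins:
  assumes "first_kind S" "card S = 4" "pairwise (\<lambda>f g. \<not> proportional f g) S"
  shows "cousins {qform 1 0 1, qform \<omega> 0 (\<omega>\<^sup>2), qform (\<omega>\<^sup>2) 0 \<omega>, qform 0 1 0} S"
proof -
  obtain A B D where h: "is_quadratic A" "is_quadratic B" "is_quadratic D"
     "independent_pair A B" "A * B = D * D"
     and cov: "covered {A + B, fscale \<omega> A + fscale (\<omega>\<^sup>2) B, fscale (\<omega>\<^sup>2) A + fscale \<omega> B, D} S"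
    using assms(1) unfolding first_kind_def by blast
  obtain L where L: "linear_change L" "A = qform 1 0 0 \<circ> L" "B = qform 0 0 1 \<circ> L" "D = qform 0 1 0 \<circ> L"
    using product_square_normal_form[OF h] by blast
  have eqs: "A + B = qform 1 0 1 \<circ> L" "fscale \<omega> A + fscale (\<omega>\<^sup>2) B = qform \<omega> 0 (\<omega>\<^sup>2) \<circ> L"
    "fscale (\<omega>\<^sup>2) A + fscale \<omega> B = qform (\<omega>\<^sup>2) 0 \<omega> \<circ> L"
    unfolding L by (simp_all add: fun_eq_iff fscale_def qform_def split_beta)
  show ?thesis
  proof (rule cousinsI[OF _ _ _ assms(3) L(1)])
    show "covered ((\<lambda>f. f \<circ> L) ` {qform 1 0 1, qform \<omega> 0 (\<omega>\<^sup>2), qform (\<omega>\<^sup>2) 0 \<omega>, qform 0 1 0}) S"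
      using cov unfolding eqs L(4) by simp
    show "finite S" using assms(2) by (simp add: card_ge_0_finite)
    show "card {qform 1 0 1, qform \<omega> 0 (\<omega>\<^sup>2), qform (\<omega>\<^sup>2) 0 \<omega>, qform 0 1 0} \<le> card S"
      unfolding assms(2) by (simp add: card_insert_if)
  qed simp
qed

lemma second_kind_cousins:
  assumes "second_kind S" "card S = 4" "pairwise (\<lambda>f g. \<not> proportional f g) S"
  shows "cousins (pair_set (qform 1 sqrt3 (-1), fscale \<zeta> (qform 1 (- sqrt3) (-1))) \<union>
         pair_set (qform (\<omega>\<^sup>2) sqrt3 (- \<omega>), fscale \<zeta> (qform (\<omega>\<^sup>2) (- sqrt3) (- \<omega>)))) S"
    (is "cousins ?F S")
proof -
  obtain A B D where h: "is_quadratic A" "is_quadratic B" "is_quadratic D"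
     "independent_pair A B" "A * B = D * D"
     and cov: "covered {A + fscale sqrt3 D - B, A - fscale sqrt3 D - B,
       fscale (\<omega>\<^sup>2) A + fscale sqrt3 D - fscale \<omega> B,
       fscale (\<omega>\<^sup>2) A - fscale sqrt3 D - fscale \<omega> B} S"
    using assms(1) unfolding second_kind_def by blast
  obtain L where L: "linear_change L" "A = qform 1 0 0 \<circ> L" "B = qform 0 0 1 \<circ> L" "D = qform 0 1 0 \<circ> L"
    using product_square_normal_form[OF h] by blast
  have eqs: "A + fscale sqrt3 D - B = qform 1 sqrt3 (-1) \<circ> L"
    "A - fscale sqrt3 D - B = qform 1 (- sqrt3) (-1) \<circ> L"
    "fscale (\<omega>\<^sup>2) A + fscale sqrt3 D - fscale \<omega> B = qform (\<omega>\<^sup>2) sqrt3 (- \<omega>) \<circ> L"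
    "fscale (\<omega>\<^sup>2) A - fscale sqrt3 D - fscale \<omega> B = qform (\<omega>\<^sup>2) (- sqrt3) (- \<omega>) \<circ> L"
    unfolding L by (simp_all add: fun_eq_iff fscale_def qform_def split_beta algebra_simps)
  have F: "?F = {qform 1 sqrt3 (-1), fscale \<zeta> (qform 1 (- sqrt3) (-1)),
     qform (\<omega>\<^sup>2) sqrt3 (- \<omega>), fscale \<zeta> (qform (\<omega>\<^sup>2) (- sqrt3) (- \<omega>))}" by auto
  have refl: "proportional f f" for f by (rule proportionalI[of 1]) (auto simp: fscale_def)
  have z: "proportional (fscale \<zeta> f \<circ> L) (f \<circ> L)" for f
    by (rule proportionalI[of "1 / \<zeta>"]) (auto simp: zeta_nonzero fscale_def fun_eq_iff)
  have "covered ((\<lambda>f. f \<circ> L) ` ?F) {qform 1 sqrt3 (-1) \<circ> L, qform 1 (- sqrt3) (-1) \<circ> L,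
     qform (\<omega>\<^sup>2) sqrt3 (- \<omega>) \<circ> L, qform (\<omega>\<^sup>2) (- sqrt3) (- \<omega>) \<circ> L}"
    unfolding F by (simp add: refl z)
  then have cov': "covered ((\<lambda>f. f \<circ> L) ` ?F) S"
    using covered_trans cov unfolding eqs by blast
  show ?thesis
  proof (rule cousinsI[OF _ _ _ assms(3) L(1) cov'])
    show "finite S" using assms(2) by (simp add: card_ge_0_finite)
    show "card ?F \<le> card S"
      unfolding assms(2) F by (simp add: card_insert_if)
  qed simp
qed

lemma pair_pow_sum_zeta:
  "pair_pow_sum 4 (f, fscale \<zeta> g) = (\<lambda>v. f v ^ 4 - g v ^ 4)"
  by (simp add: fun_eq_iff fscale_def power_mult_distrib zeta_power4)

section \<open>Sums of two fourth powers of linear forms\<close>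

text \<open>
  The lemmas of this section concern \<open>P(u) = (A\<^sub>1u + B\<^sub>1)\<^sup>4 + (A\<^sub>2u + B\<^sub>2)\<^sup>4\<close> for two linear forms. Up
  to binomial factors its coefficients are the sums \<open>A\<^sub>1\<^sup>jB\<^sub>1\<^bsup>4-j\<^esup> + A\<^sub>2\<^sup>jB\<^sub>2\<^bsup>4-j\<^esup>\<close>. If the linear forms
  are not proportional, then \<open>P\<close> is square-free as a binary form, so its degree is at least 3.
\<close>

lemma proportional_if_degree_small:
  fixes A1 A2 B1 B2 :: complex
  assumes "A1 ^ 4 + A2 ^ 4 = 0" "A1 ^ 3 * B1 + A2 ^ 3 * B2 = 0"
  shows "A1 * B2 = A2 * B1"
proof (cases "A1 = 0")
  case True
  then show ?thesis using assms by auto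
next
  case False
  have "A1 ^ 3 * (A1 * B2 - A2 * B1) = 0" using assms by algebra
  then show ?thesis using False by auto
qed

text \<open>
  If \<open>P\<close> is a multiple of \<open>u\<^sup>3 - 3\<gamma>u\<close> up to a constant, then it is a multiple of
  \<open>(u + b)\<^sup>4 - (u - b)\<^sup>4 = 8b(u\<^sup>3 + b\<^sup>2u)\<close>, and comparison gives \<open>b\<close>.
\<close>

lemma odd_sum_of_two_powers:
  fixes A1 A2 B1 B2 :: complex
  assumes "A1 ^ 4 + A2 ^ 4 = 0" "A1\<^sup>2 * B1\<^sup>2 + A2\<^sup>2 * B2\<^sup>2 = 0"
    "A1 * B1 ^ 3 + A2 * B2 ^ 3 = - 3 * \<gamma> * (A1 ^ 3 * B1 + A2 ^ 3 * B2)"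
    and ne: "A1 ^ 3 * B1 + A2 ^ 3 * B2 \<noteq> 0"
  shows "\<exists>b. A1 \<noteq> 0 \<and> A2 \<noteq> 0 \<and> b \<noteq> 0 \<and> B1 = A1 * b \<and> B2 = - A2 * b \<and> b\<^sup>2 = - 3 * \<gamma>"
proof -
  have A1: "A1 \<noteq> 0" and A2: "A2 \<noteq> 0" using assms(1) ne by auto
  define b where "b = B1 / A1"
  define c where "c = B2 / A2"
  have B1: "B1 = A1 * b" and B2: "B2 = A2 * c" using A1 A2 by (auto simp: b_def c_def)
  have "A1 ^ 4 * ((b - c) * (b + c)) = 0"
    using assms(1,2) unfolding B1 B2 by algebra
  then have "b = c \<or> c = - b" using A1 by (auto simp: eq_neg_iff_add_eq_0 add.commute)
  moreover have "b \<noteq> c" using ne assms(1) unfolding B1 B2 by algebra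
  ultimately have c: "c = - b" by simp
  have b0: "b \<noteq> 0" using \<open>b \<noteq> c\<close> c by auto
  have "A1 ^ 4 * b * (b\<^sup>2 + 3 * \<gamma>) = 0"
    using assms(1,3) unfolding B1 B2 c by algebra
  then have "b\<^sup>2 = - 3 * \<gamma>" using A1 b0 by (simp add: eq_neg_iff_add_eq_0)
  then show ?thesis using A1 A2 b0 B1 B2 c by auto
qed

text \<open>
  An even \<open>P\<close> is, up to scalars, \<open>u\<^sup>4 + c\<close> or \<open>(u + b)\<^sup>4 + (u - b)\<^sup>4\<close>.
\<close>

lemma even_sum_of_two_powers:
  fixes A1 A2 B1 B2 :: complex
  assumes e: "A1 ^ 3 * B1 + A2 ^ 3 * B2 = 0" "A1 * B1 ^ 3 + A2 * B2 ^ 3 = 0"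
    and ne: "A1 * B2 \<noteq> A2 * B1"
  shows "(A1 = 0 \<and> B2 = 0 \<and> A2 \<noteq> 0 \<and> B1 \<noteq> 0) \<or> (A2 = 0 \<and> B1 = 0 \<and> A1 \<noteq> 0 \<and> B2 \<noteq> 0) \<or>
    (\<exists>b. A1 \<noteq> 0 \<and> A2 \<noteq> 0 \<and> b \<noteq> 0 \<and> B1 = A1 * b \<and> B2 = - A2 * b \<and> A2 ^ 4 = A1 ^ 4)"
proof (cases "A1 = 0 \<or> A2 = 0")
  case True
  then show ?thesis using assms by auto
next
  case False
  define b where "b = B1 / A1"
  define c where "c = B2 / A2"
  have B1: "B1 = A1 * b" and B2: "B2 = A2 * c" using False by (auto simp: b_def c_def)
  have "b \<noteq> c" using ne unfolding B1 B2 by auto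
  have "A1 ^ 4 * b * ((b - c) * (b + c)) = 0"
    using e unfolding B1 B2 by algebra
  moreover have "b \<noteq> 0" using e \<open>b \<noteq> c\<close> False unfolding B1 B2 by auto
  ultimately have c: "c = - b" using \<open>b \<noteq> c\<close> False by (auto simp: eq_neg_iff_add_eq_0 add.commute)
  have "b * (A2 ^ 4 - A1 ^ 4) = 0" using e(1) unfolding B1 B2 c by algebra
  then show ?thesis using \<open>b \<noteq> 0\<close> False B1 B2 c by auto
qed

text \<open>
  Apply to \<open>\<Sum>(A\<^sub>iu + B\<^sub>iv)\<^sup>4 = 0\<close>, by apolarity, the two quartics \<open>A\<Prod>(AB\<^sub>j - A\<^sub>jB)\<close> and
  \<open>B\<Prod>(AB\<^sub>j - A\<^sub>jB)\<close> with \<open>j = 2, 3, 4\<close>: only the first summand survives.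
\<close>

lemma four_linear_forms:
  fixes A1 A2 A3 A4 B1 B2 B3 B4 :: complex
  assumes "A1 * B2 \<noteq> A2 * B1" "A1 * B3 \<noteq> A3 * B1" "A1 * B4 \<noteq> A4 * B1"
    and "A1 ^ 4 + A2 ^ 4 + A3 ^ 4 + A4 ^ 4 = 0"
     "A1 ^ 3 * B1 + A2 ^ 3 * B2 + A3 ^ 3 * B3 + A4 ^ 3 * B4 = 0"
     "A1\<^sup>2 * B1\<^sup>2 + A2\<^sup>2 * B2\<^sup>2 + A3\<^sup>2 * B3\<^sup>2 + A4\<^sup>2 * B4\<^sup>2 = 0"
     "A1 * B1 ^ 3 + A2 * B2 ^ 3 + A3 * B3 ^ 3 + A4 * B4 ^ 3 = 0"
     "B1 ^ 4 + B2 ^ 4 + B3 ^ 4 + B4 ^ 4 = 0"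
  shows False
proof -
  have "A1 * ((A1 * B2 - A2 * B1) * ((A1 * B3 - A3 * B1) * (A1 * B4 - A4 * B1))) = 0"
    using assms(4-7) by algebra
  moreover have "B1 * ((A1 * B2 - A2 * B1) * ((A1 * B3 - A3 * B1) * (A1 * B4 - A4 * B1))) = 0"
    using assms(5-8) by algebra
  ultimately show False using assms(1-3) by auto
qed

section \<open>The configurations that occur\<close>

text \<open>
  The forms are \<open>v\<close>, \<open>s\<close>, \<open>t + bv\<close> and \<open>t - bv\<close> for \<open>v = xy\<close>, \<open>s = x\<^sup>2 + \<gamma>y\<^sup>2\<close> and \<open>t = x\<^sup>2 - \<gamma>y\<^sup>2\<close>. The
  three forms \<open>2bv\<close>, \<open>- t - bv\<close> and \<open>t - bv\<close> sum to zero, and \<open>A\<close> and \<open>B\<close> are the solutions of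
  \<open>A + B = 2bv\<close>, \<open>\<omega>A + \<omega>\<^sup>2B = - t - bv\<close>; their product is \<open>s\<^sup>2/3\<close>.
\<close>

lemma first_kind_opposite_pencils:
  assumes "b\<^sup>2 = 4 * \<gamma> / 3" "\<gamma> \<noteq> 0" "B1 \<noteq> 0" "A2 \<noteq> 0" "A3 \<noteq> 0" "A4 \<noteq> 0"
  shows "first_kind {qform 0 B1 0, qform A2 0 (A2 * \<gamma>),
     qform A3 (A3 * b) (- A3 * \<gamma>), qform A4 (- A4 * b) (- A4 * \<gamma>)}"
proof -
  have b: "b \<noteq> 0" using assms by auto
  \<comment> \<open>This is \<open>\<i>/\<surd>3\<close>: the system for \<open>A\<close> and \<open>B\<close> gives \<open>A - B = 2\<theta>t\<close>.\<close>
  define \<theta> where "\<theta> = (2 * \<omega> + 1) / 3"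
  have th: "3 * \<theta> = 2 * \<omega> + 1" by (simp add: \<theta>_def)
  define A where "A = qform \<theta> b (- \<theta> * \<gamma>)"
  define B where "B = qform (- \<theta>) b (\<theta> * \<gamma>)"
  define e where "e = 1 / sqrt3"
  have e: "e * sqrt3 = 1" by (simp add: e_def)
  then have e2: "3 * e\<^sup>2 = 1" using sqrt3_square by algebra
  define D where "D = qform e 0 (\<gamma> * e)"
  have th2: "3 * \<theta>\<^sup>2 = - 1" using omega_square_sum th by algebra
  have "A * B = D * D"
  proof -
    have "3 * b\<^sup>2 = 4 * \<gamma>" using assms(1) by (simp add: field_simps)
    then have "- \<theta>\<^sup>2 = e\<^sup>2"
      "\<theta> * (\<theta> * \<gamma>) + b * b + - \<theta> * \<gamma> * (- \<theta>) = 2 * e * (\<gamma> * e)"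
      "- \<theta> * \<gamma> * (\<theta> * \<gamma>) = (\<gamma> * e)\<^sup>2"
      using th2 e2 by algebra+
    then show ?thesis unfolding A_def B_def D_def qform_mult_eq_iff by (simp add: power2_eq_square)
  qed
  moreover have "independent_pair A B"
  proof -
    have "\<theta> \<noteq> 0" using th2 by auto
    then show ?thesis using b unfolding A_def B_def independent_qform_iff by auto
  qed
  moreover have "is_quadratic A" "is_quadratic B" "is_quadratic D"
    unfolding A_def B_def D_def is_quadratic_def by blast+
  moreover have "A + B = qform 0 (2 * b) 0" by (simp add: A_def B_def qform_add)
  moreover have "fscale \<omega> A + fscale (\<omega>\<^sup>2) B = qform (- 1) (- b) \<gamma>"
  proof -
    have "\<omega> * \<theta> + \<omega>\<^sup>2 * (- \<theta>) = - 1" "\<omega> * b + \<omega>\<^sup>2 * b = - b"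
      "\<omega> * (- \<theta> * \<gamma>) + \<omega>\<^sup>2 * (\<theta> * \<gamma>) = \<gamma>"
      using th omega_square_sum by algebra+
    then show ?thesis by (simp only: A_def B_def qform_add fscale_qform)
  qed
  moreover have "fscale (\<omega>\<^sup>2) A + fscale \<omega> B = qform 1 (- b) (- \<gamma>)"
  proof -
    have "\<omega>\<^sup>2 * \<theta> + \<omega> * (- \<theta>) = 1" "\<omega>\<^sup>2 * b + \<omega> * b = - b"
      "\<omega>\<^sup>2 * (- \<theta> * \<gamma>) + \<omega> * (\<theta> * \<gamma>) = - \<gamma>"
      using th omega_square_sum by algebra+
    then show ?thesis by (simp only: A_def B_def qform_add fscale_qform)
  qed
  moreover have "covered {qform 0 (2 * b) 0, qform (- 1) (- b) \<gamma>, qform 1 (- b) (- \<gamma>), D}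
    {qform 0 B1 0, qform A2 0 (A2 * \<gamma>),
     qform A3 (A3 * b) (- A3 * \<gamma>), qform A4 (- A4 * b) (- A4 * \<gamma>)}"
  proof -
    have "proportional (qform 0 (2 * b) 0) (qform 0 B1 0)"
      by (rule proportionalI[of "B1 / (2 * b)"]) (use b assms in \<open>auto simp: fscale_qform\<close>)
    moreover have "proportional D (qform A2 0 (A2 * \<gamma>))"
      by (rule proportionalI[of "A2 / e"]) (use assms e in \<open>auto simp: fscale_qform D_def\<close>)
    moreover have "proportional (qform (- 1) (- b) \<gamma>) (qform A3 (A3 * b) (- A3 * \<gamma>))"
      by (rule proportionalI[of "- A3"]) (use assms in \<open>auto simp: fscale_qform\<close>)
    moreover have "proportional (qform 1 (- b) (- \<gamma>)) (qform A4 (- A4 * b) (- A4 * \<gamma>))"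
      by (rule proportionalI[of "A4"]) (use assms in \<open>auto simp: fscale_qform\<close>)
    ultimately show ?thesis by simp
  qed
  ultimately show ?thesis unfolding first_kind_def by metis
qed

text \<open>
  The forms are \<open>s \<plusminus> bv\<close> and \<open>t \<plusminus> jbv\<close> with \<open>j\<^sup>2 = - 1\<close>, so that \<open>h\<^sub>1 = s + bv\<close>, \<open>h\<^sub>2 = s - bv\<close>,
  \<open>h\<^sub>3 = - jt + bv\<close> and \<open>h\<^sub>4 = - jt - bv\<close> satisfy \<open>h\<^sub>1\<^sup>4 + h\<^sub>2\<^sup>4 = h\<^sub>3\<^sup>4 + h\<^sub>4\<^sup>4\<close> and
  \<open>h\<^sub>1 - h\<^sub>2 = h\<^sub>3 - h\<^sub>4\<close>. Pairing \<open>h\<^sub>1\<close> with \<open>h\<^sub>3\<close> and \<open>- h\<^sub>4\<close> with \<open>- h\<^sub>2\<close> makes this the second kind: \<open>h\<^sub>1\<close>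
  and \<open>h\<^sub>3\<close> are \<open>U \<plusminus> V\<close>, while \<open>- h\<^sub>4\<close> and \<open>- h\<^sub>2\<close> are \<open>W \<plusminus> V\<close> for the same \<open>V\<close>.
\<close>

lemma second_kind_opposite_pencils:
  assumes "3 * b\<^sup>2 = - 2 * \<gamma>" "b'\<^sup>2 = - b\<^sup>2" "\<gamma> \<noteq> 0" "A1 \<noteq> 0" "A2 \<noteq> 0" "A3 \<noteq> 0" "A4 \<noteq> 0"
  shows "second_kind {qform A1 (A1 * b) (A1 * \<gamma>), qform A2 (- A2 * b) (A2 * \<gamma>),
     qform A3 (A3 * b') (- A3 * \<gamma>), qform A4 (- A4 * b') (- A4 * \<gamma>)}"
proof -
  have b: "b \<noteq> 0" using assms by auto
  define j where "j = b' / b"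
  have b': "b' = j * b" using b by (simp add: j_def)
  have "b\<^sup>2 * (j\<^sup>2 + 1) = 0" using assms(2) unfolding b' by algebra
  then have j: "j\<^sup>2 = - 1" using b by (simp add: eq_neg_iff_add_eq_0)
  then have j0: "j \<noteq> 0" by auto
  define U where "U = qform ((1 - j) / 2) b (\<gamma> * (1 + j) / 2)"
  define W where "W = qform (- (1 - j) / 2) b (- \<gamma> * (1 + j) / 2)"
  define V where "V = qform ((1 + j) / 2) 0 (\<gamma> * (1 - j) / 2)"
  have d: "independent_pair U W"
  proof -
    have "1 - j \<noteq> 0" using j by auto
    then show ?thesis using b unfolding U_def W_def independent_qform_iff by auto
  qed
  have conic: "(U v)\<^sup>2 + U v * W v + (W v)\<^sup>2 + (V v)\<^sup>2 = 0" for v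
  proof -
    obtain x y where v: "v = (x, y)" by (cases v)
    have "2 * U v = (1 - j) * x\<^sup>2 + 2 * b * x * y + \<gamma> * (1 + j) * y\<^sup>2"
      "2 * W v = - (1 - j) * x\<^sup>2 + 2 * b * x * y - \<gamma> * (1 + j) * y\<^sup>2"
      "2 * V v = (1 + j) * x\<^sup>2 + \<gamma> * (1 - j) * y\<^sup>2"
      by (simp_all add: U_def W_def V_def v qform_apply field_simps)
    then have "4 * ((U v)\<^sup>2 + U v * W v + (W v)\<^sup>2 + (V v)\<^sup>2) = 0"
      using j assms(1) by algebra
    then show ?thesis by algebra
  qed
  have "U + V = qform 1 b \<gamma>" "W - V = qform (- 1) b (- \<gamma>)"
    "U - V = qform (- j) b (j * \<gamma>)" "W + V = qform j b (- j * \<gamma>)"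
    by (simp_all add: U_def V_def W_def qform_add qform_diff field_simps)
  moreover have "covered {qform j b (- j * \<gamma>), qform (- 1) b (- \<gamma>), qform 1 b \<gamma>, qform (- j) b (j * \<gamma>)}
    {qform A1 (A1 * b) (A1 * \<gamma>), qform A2 (- A2 * b) (A2 * \<gamma>),
     qform A3 (A3 * b') (- A3 * \<gamma>), qform A4 (- A4 * b') (- A4 * \<gamma>)}"
  proof -
    have jj: "j * (j * z) = - z" "j * j = - 1" for z using j by algebra+
    have "proportional (qform 1 b \<gamma>) (qform A1 (A1 * b) (A1 * \<gamma>))"
      by (rule proportionalI[of "A1"]) (use assms in \<open>auto simp: fscale_qform\<close>)
    moreover have "proportional (qform (- 1) b (- \<gamma>)) (qform A2 (- A2 * b) (A2 * \<gamma>))"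
      by (rule proportionalI[of "- A2"]) (use assms in \<open>auto simp: fscale_qform\<close>)
    moreover have "proportional (qform (- j) b (j * \<gamma>)) (qform A3 (A3 * b') (- A3 * \<gamma>))"
      by (rule proportionalI[of "A3 * j"]) (use assms j0 jj in \<open>auto simp: fscale_qform b' mult.assoc\<close>)
    moreover have "proportional (qform j b (- j * \<gamma>)) (qform A4 (- A4 * b') (- A4 * \<gamma>))"
      by (rule proportionalI[of "- A4 * j"]) (use assms j0 jj in \<open>auto simp: fscale_qform b' mult.assoc\<close>)
    ultimately show ?thesis by simp
  qed
  ultimately have "covered {W + V, W - V, U + V, U - V}
   {qform A1 (A1 * b) (A1 * \<gamma>), qform A2 (- A2 * b) (A2 * \<gamma>),
     qform A3 (A3 * b') (- A3 * \<gamma>), qform A4 (- A4 * b') (- A4 * \<gamma>)}" by simp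
  moreover have "is_quadratic U" "is_quadratic V" "is_quadratic W"
    unfolding U_def V_def W_def is_quadratic_def by blast+
  ultimately show ?thesis using second_kind_if_conic[of U V W] d conic by blast
qed

text \<open>
  Here \<open>\<gamma>'/\<gamma>\<close> is a primitive cube root of unity with square root \<open>\<sigma>\<close>, also a cube root of unity,
  and \<open>b' = \<plusminus>\<sigma>b\<close>. Multiplying \<open>x\<^sup>2 + \<gamma>y\<^sup>2 \<plusminus> bxy\<close> by \<open>\<sigma>\<close> makes the terms in \<open>xy\<close> of the two pairs
  agree.
\<close>

lemma second_kind_cube_root_pencils:
  assumes b: "b\<^sup>2 = - 3 * \<gamma>" and b': "b'\<^sup>2 = - 3 * \<gamma>'" and g: "\<gamma>\<^sup>2 + \<gamma> * \<gamma>' + \<gamma>'\<^sup>2 = 0"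
   and nz: "\<gamma> \<noteq> 0" "A1 \<noteq> 0" "A2 \<noteq> 0" "A3 \<noteq> 0" "A4 \<noteq> 0"
  shows "second_kind {qform A1 (A1 * b) (A1 * \<gamma>), qform A2 (- A2 * b) (A2 * \<gamma>),
     qform A3 (A3 * b') (A3 * \<gamma>'), qform A4 (- A4 * b') (A4 * \<gamma>')}"
proof -
  define \<sigma> where "\<sigma> = (\<gamma>' / \<gamma>)\<^sup>2"
  have "\<gamma>\<^sup>2 * ((\<gamma>' / \<gamma>)\<^sup>2 + \<gamma>' / \<gamma> + 1) = 0" using g nz by (simp add: field_simps power2_eq_square)
  then have rho: "(\<gamma>' / \<gamma>)\<^sup>2 + \<gamma>' / \<gamma> + 1 = 0" using nz by simp
  have s: "\<sigma>\<^sup>2 + \<sigma> + 1 = 0" "\<sigma>\<^sup>2 = \<gamma>' / \<gamma>" using rho unfolding \<sigma>_def by algebra+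
  have g': "\<gamma>' = \<sigma>\<^sup>2 * \<gamma>" using s nz by simp
  have s0: "\<sigma> \<noteq> 0" using s(1) by auto
  define U where "U = qform 1 0 \<gamma>'"
  define W where "W = qform \<sigma> 0 (\<sigma> * \<gamma>)"
  define V where "V = qform 0 (\<sigma> * b) 0"
  have "\<gamma> \<noteq> \<gamma>'" using g nz by algebra
  then have d: "independent_pair U W"
    using s0 unfolding U_def W_def independent_qform_iff by auto
  have conic: "(U v)\<^sup>2 + U v * W v + (W v)\<^sup>2 + (V v)\<^sup>2 = 0" for v
  proof -
    obtain x y where v: "v = (x, y)" by (cases v)
    show ?thesis using s(1) b unfolding U_def W_def V_def v qform_apply g' by algebra
  qed
  have UV: "U + V = qform 1 (\<sigma> * b) \<gamma>'" "U - V = qform 1 (- \<sigma> * b) \<gamma>'"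
    "W + V = qform \<sigma> (\<sigma> * b) (\<sigma> * \<gamma>)" "W - V = qform \<sigma> (- \<sigma> * b) (\<sigma> * \<gamma>)"
    by (simp_all add: U_def V_def W_def qform_add qform_diff)
  have "(b' - \<sigma> * b) * (b' + \<sigma> * b) = 0"
    using b b' unfolding g' by algebra
  then have bb: "b' = \<sigma> * b \<or> b' = - (\<sigma> * b)" by (auto simp: eq_neg_iff_add_eq_0)
  have p: "proportional (U + V) (qform k (k * \<sigma> * b) (k * \<gamma>'))"
    "proportional (U - V) (qform k (- k * \<sigma> * b) (k * \<gamma>'))" if "k \<noteq> 0" for k
    using that unfolding UV by (auto intro!: proportionalI[of k] simp: fscale_qform mult.assoc)
  have "proportional (W + V) (qform A1 (A1 * b) (A1 * \<gamma>))"
    using nz s0 unfolding UV by (intro proportionalI[of "A1 / \<sigma>"]) (auto simp: fscale_qform)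
  moreover have "proportional (W - V) (qform A2 (- A2 * b) (A2 * \<gamma>))"
    using nz s0 unfolding UV by (intro proportionalI[of "A2 / \<sigma>"]) (auto simp: fscale_qform)
  ultimately have "covered {W + V, W - V, U + V, U - V}
   {qform A1 (A1 * b) (A1 * \<gamma>), qform A2 (- A2 * b) (A2 * \<gamma>),
     qform A3 (A3 * b') (A3 * \<gamma>'), qform A4 (- A4 * b') (A4 * \<gamma>')}"
    using bb p[of A3] p[of A4] nz by (auto simp: mult.assoc)
  moreover have "is_quadratic U" "is_quadratic V" "is_quadratic W"
    unfolding U_def V_def W_def is_quadratic_def by blast+
  ultimately show ?thesis using second_kind_if_conic[of U V W] d conic by blast
qed

section \<open>Comparison of coefficients\<close>

definition power4_coeff :: "complex \<Rightarrow> complex \<Rightarrow> complex \<Rightarrow> nat \<Rightarrow> complex" where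
  "power4_coeff a b c n =
     [c ^ 4, 4 * b * c ^ 3, 4 * a * c ^ 3 + 6 * b\<^sup>2 * c\<^sup>2, 12 * a * b * c\<^sup>2 + 4 * b ^ 3 * c,
      6 * a\<^sup>2 * c\<^sup>2 + 12 * a * b\<^sup>2 * c + b ^ 4,
      12 * a\<^sup>2 * b * c + 4 * a * b ^ 3, 4 * a ^ 3 * c + 6 * a\<^sup>2 * b\<^sup>2, 4 * a ^ 3 * b, a ^ 4] ! n"

lemma power4_coeff:
  "power4_coeff a b c 0 = c ^ 4"
  "power4_coeff a b c 1 = 4 * b * c ^ 3"
  "power4_coeff a b c 2 = 4 * a * c ^ 3 + 6 * b\<^sup>2 * c\<^sup>2"
  "power4_coeff a b c 3 = 12 * a * b * c\<^sup>2 + 4 * b ^ 3 * c"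
  "power4_coeff a b c 4 = 6 * a\<^sup>2 * c\<^sup>2 + 12 * a * b\<^sup>2 * c + b ^ 4"
  "power4_coeff a b c 5 = 12 * a\<^sup>2 * b * c + 4 * a * b ^ 3"
  "power4_coeff a b c 6 = 4 * a ^ 3 * c + 6 * a\<^sup>2 * b\<^sup>2"
  "power4_coeff a b c 7 = 4 * a ^ 3 * b"
  "power4_coeff a b c 8 = a ^ 4"
  by (simp_all add: power4_coeff_def)

lemma quadratic_power4: "(a * x\<^sup>2 + b * x + c) ^ 4 = (\<Sum>n\<le>8. power4_coeff a b c n * x ^ n)"
proof -
  have "(\<Sum>n\<le>8. power4_coeff a b c n * x ^ n) =
    power4_coeff a b c 0 + power4_coeff a b c 1 * x + power4_coeff a b c 2 * x\<^sup>2
    + power4_coeff a b c 3 * x ^ 3 + power4_coeff a b c 4 * x ^ 4 + power4_coeff a b c 5 * x ^ 5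
    + power4_coeff a b c 6 * x ^ 6 + power4_coeff a b c 7 * x ^ 7 + power4_coeff a b c 8 * x ^ 8"
    by (simp add: eval_nat_numeral)
  then show ?thesis unfolding power4_coeff by algebra
qed

lemma power4_sum_coeffs:
  assumes "\<And>x. k1 * (a1 * x\<^sup>2 + b1 * x + c1) ^ 4 + k2 * (a2 * x\<^sup>2 + b2 * x + c2) ^ 4
    + k3 * (a3 * x\<^sup>2 + b3 * x + c3) ^ 4 + k4 * (a4 * x\<^sup>2 + b4 * x + c4) ^ 4 = 0"
    and "n \<le> 8"
  shows "k1 * power4_coeff a1 b1 c1 n + k2 * power4_coeff a2 b2 c2 n
    + k3 * power4_coeff a3 b3 c3 n + k4 * power4_coeff a4 b4 c4 n = 0"
proof -
  have "(\<Sum>n\<le>8. (k1 * power4_coeff a1 b1 c1 n + k2 * power4_coeff a2 b2 c2 n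
    + k3 * power4_coeff a3 b3 c3 n + k4 * power4_coeff a4 b4 c4 n) * x ^ n) = 0" for x
    using assms(1)[of x] unfolding quadratic_power4
    by (simp add: sum_distrib_left sum.distrib algebra_simps)
  then show ?thesis
    using polyfun_eq_0[of "\<lambda>n. k1 * power4_coeff a1 b1 c1 n + k2 * power4_coeff a2 b2 c2 n
    + k3 * power4_coeff a3 b3 c3 n + k4 * power4_coeff a4 b4 c4 n" 8] assms(2) by blast
qed

lemma power4_sum_coeffs_unweighted:
  assumes "\<And>x. (a1 * x\<^sup>2 + b1 * x + c1) ^ 4 + (a2 * x\<^sup>2 + b2 * x + c2) ^ 4
    + (a3 * x\<^sup>2 + b3 * x + c3) ^ 4 + (a4 * x\<^sup>2 + b4 * x + c4) ^ 4 = 0"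
    and "n \<le> 8"
  shows "power4_coeff a1 b1 c1 n + power4_coeff a2 b2 c2 n
    + power4_coeff a3 b3 c3 n + power4_coeff a4 b4 c4 n = 0"
  using power4_sum_coeffs[of 1 a1 b1 c1 1 a2 b2 c2 1 a3 b3 c3 1 a4 b4 c4 n] assms by simp

text \<open>
  Besides \<open>xy\<close>, the generators of the pencils are normalised to \<open>x\<^sup>2 + \<gamma>y\<^sup>2\<close> and \<open>x\<^sup>2 + \<gamma>'y\<^sup>2\<close>. The sums
  \<open>P\<^sub>j\<close> and \<open>Q\<^sub>j\<close> below are, up to binomial factors, the coefficients of the two binary quartics, and
  the equations \<open>eqs\<close> are, up to numerical factors, relations \<open>C\<^sub>k + C'\<^sub>k = 0\<close> and \<open>\<gamma>\<^sup>kC\<^sub>k + \<gamma>'\<^sup>kC'\<^sub>k = 0\<close>. They give \<open>C\<^sub>1 = 0\<close> and, for \<open>k = 2, 3, 4\<close>,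
  \<open>C\<^sub>k = 0\<close> or \<open>\<gamma>\<^sup>k = \<gamma>'\<^sup>k\<close>.
\<close>

lemma pencils_through_xy_normalised:
  fixes A1 A2 A3 A4 B1 B2 B3 B4 \<gamma> \<gamma>' :: complex
  assumes nz: "\<gamma> \<noteq> 0" "\<gamma>' \<noteq> 0" and neq: "\<gamma> \<noteq> \<gamma>'"
    and n12: "A1 * B2 \<noteq> A2 * B1" and n34: "A3 * B4 \<noteq> A4 * B3"
    and eq: "\<And>x. (A1 * x\<^sup>2 + B1 * x + A1 * \<gamma>) ^ 4 + (A2 * x\<^sup>2 + B2 * x + A2 * \<gamma>) ^ 4
      + (A3 * x\<^sup>2 + B3 * x + A3 * \<gamma>') ^ 4 + (A4 * x\<^sup>2 + B4 * x + A4 * \<gamma>') ^ 4 = 0"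
  shows "first_kind {qform A1 B1 (A1 * \<gamma>), qform A2 B2 (A2 * \<gamma>), qform A3 B3 (A3 * \<gamma>'), qform A4 B4 (A4 * \<gamma>')} \<or>
    second_kind {qform A1 B1 (A1 * \<gamma>), qform A2 B2 (A2 * \<gamma>), qform A3 B3 (A3 * \<gamma>'), qform A4 B4 (A4 * \<gamma>')}"
    (is "first_kind ?S \<or> second_kind ?S")
proof -
  define P4 where "P4 = A1 ^ 4 + A2 ^ 4"
  define Q4 where "Q4 = A3 ^ 4 + A4 ^ 4"
  define P0 where "P0 = B1 ^ 4 + B2 ^ 4"
  define Q0 where "Q0 = B3 ^ 4 + B4 ^ 4"
  define P3 where "P3 = A1 ^ 3 * B1 + A2 ^ 3 * B2"
  define Q3 where "Q3 = A3 ^ 3 * B3 + A4 ^ 3 * B4"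
  define P2 where "P2 = A1\<^sup>2 * B1\<^sup>2 + A2\<^sup>2 * B2\<^sup>2"
  define Q2 where "Q2 = A3\<^sup>2 * B3\<^sup>2 + A4\<^sup>2 * B4\<^sup>2"
  define P1 where "P1 = A1 * B1 ^ 3 + A2 * B2 ^ 3"
  define Q1 where "Q1 = A3 * B3 ^ 3 + A4 * B4 ^ 3"
  note defs = P4_def Q4_def P3_def Q3_def P2_def Q2_def P1_def Q1_def P0_def Q0_def
  note cs = power4_sum_coeffs_unweighted[OF eq]
  note c = cs[of 0] cs[of 1] cs[of 2] cs[of 3] cs[of 4] cs[of 5] cs[of 6] cs[of 7] cs[of 8]
  note c = c[simplified, unfolded power4_coeff[simplified]]
  have eqs: "P4 + Q4 = 0" "P3 + Q3 = 0"
    "\<gamma> ^ 3 * P3 + \<gamma>' ^ 3 * Q3 = 0" "\<gamma> ^ 4 * P4 + \<gamma>' ^ 4 * Q4 = 0"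
    "(3 * P2 + 2 * \<gamma> * P4) + (3 * Q2 + 2 * \<gamma>' * Q4) = 0"
    "\<gamma>\<^sup>2 * (3 * P2 + 2 * \<gamma> * P4) + \<gamma>'\<^sup>2 * (3 * Q2 + 2 * \<gamma>' * Q4) = 0"
    "(P1 + 3 * \<gamma> * P3) + (Q1 + 3 * \<gamma>' * Q3) = 0"
    "\<gamma> * (P1 + 3 * \<gamma> * P3) + \<gamma>' * (Q1 + 3 * \<gamma>' * Q3) = 0"
    "P0 + 12 * \<gamma> * P2 + 6 * \<gamma>\<^sup>2 * P4 + (Q0 + 12 * \<gamma>' * Q2 + 6 * \<gamma>'\<^sup>2 * Q4) = 0"
    unfolding defs using c by algebra+
  have Q4: "Q4 = - P4" and Q3: "Q3 = - P3"
    using eqs(1,2) by (auto simp: eq_neg_iff_add_eq_0 add.commute)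
  have "(\<gamma> - \<gamma>') * (P1 + 3 * \<gamma> * P3) = 0" using eqs by algebra
  then have P1: "P1 = - 3 * \<gamma> * P3" using neq by (simp add: eq_neg_iff_add_eq_0)
  have "(\<gamma>' - \<gamma>) * (Q1 + 3 * \<gamma>' * Q3) = 0" using eqs by algebra
  then have Q1: "Q1 = - 3 * \<gamma>' * Q3" using neq by (simp add: eq_neg_iff_add_eq_0)
  have three: "(\<gamma> - \<gamma>') * ((\<gamma>\<^sup>2 + \<gamma> * \<gamma>' + \<gamma>'\<^sup>2) * P3) = 0" using eqs by algebra
  have four: "(\<gamma> - \<gamma>') * ((\<gamma> + \<gamma>') * (\<gamma>\<^sup>2 + \<gamma>'\<^sup>2) * P4) = 0" using eqs by algebra
  have two: "(\<gamma> - \<gamma>') * ((\<gamma> + \<gamma>') * (3 * P2 + 2 * \<gamma> * P4)) = 0"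
     "(\<gamma> - \<gamma>') * ((\<gamma> + \<gamma>') * (3 * Q2 + 2 * \<gamma>' * Q4)) = 0" using eqs by algebra+
  show ?thesis
  proof (cases "P3 = 0")
    case False
    \<comment> \<open>A nonzero \<open>C\<^sub>3\<close> makes \<open>\<gamma>'/\<gamma>\<close> a primitive cube root of unity, so \<open>C\<^sub>2\<close> and \<open>C\<^sub>4\<close> vanish.\<close>
    then have g: "\<gamma>\<^sup>2 + \<gamma> * \<gamma>' + \<gamma>'\<^sup>2 = 0" using three neq by auto
    have "\<gamma> + \<gamma>' \<noteq> 0" "\<gamma>\<^sup>2 + \<gamma>'\<^sup>2 \<noteq> 0" using g nz by algebra+
    then have z: "P4 = 0" "Q4 = 0" "P2 = 0" "Q2 = 0" using four two neq Q4 by auto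
    obtain b where b: "A1 \<noteq> 0" "A2 \<noteq> 0" "b \<noteq> 0" "B1 = A1 * b" "B2 = - A2 * b" "b\<^sup>2 = - 3 * \<gamma>"
      using odd_sum_of_two_powers[of A1 A2 B1 B2 \<gamma>] z P1 False unfolding defs by blast
    have "Q3 \<noteq> 0" using Q3 False by simp
    then obtain b' where b': "A3 \<noteq> 0" "A4 \<noteq> 0" "b' \<noteq> 0" "B3 = A3 * b'" "B4 = - A4 * b'" "b'\<^sup>2 = - 3 * \<gamma>'"
      using odd_sum_of_two_powers[of A3 A4 B3 B4 \<gamma>'] z Q1 unfolding defs by blast
    show ?thesis
      using second_kind_cube_root_pencils[OF b(6) b'(6) g nz(1) b(1,2) b'(1,2)] unfolding b(4,5) b'(4,5) by blast
  next
    case True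
    \<comment> \<open>Both quartics are even; each has one of the two shapes of \<open>even_sum_of_two_powers\<close>.\<close>
    then have z: "P3 = 0" "Q3 = 0" "P1 = 0" "Q1 = 0" using Q3 P1 Q1 by auto
    have P4: "P4 \<noteq> 0" using proportional_if_degree_small[of A1 A2 B1 B2] z n12 unfolding defs by blast
    have T12: "(A1 = 0 \<and> B2 = 0 \<and> A2 \<noteq> 0 \<and> B1 \<noteq> 0) \<or> (A2 = 0 \<and> B1 = 0 \<and> A1 \<noteq> 0 \<and> B2 \<noteq> 0) \<or>
      (\<exists>b. A1 \<noteq> 0 \<and> A2 \<noteq> 0 \<and> b \<noteq> 0 \<and> B1 = A1 * b \<and> B2 = - A2 * b \<and> A2 ^ 4 = A1 ^ 4)"
      using even_sum_of_two_powers[of A1 B1 A2 B2] z n12 unfolding defs by blast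
    have T34: "(A3 = 0 \<and> B4 = 0 \<and> A4 \<noteq> 0 \<and> B3 \<noteq> 0) \<or> (A4 = 0 \<and> B3 = 0 \<and> A3 \<noteq> 0 \<and> B4 \<noteq> 0) \<or>
      (\<exists>b. A3 \<noteq> 0 \<and> A4 \<noteq> 0 \<and> b \<noteq> 0 \<and> B3 = A3 * b \<and> B4 = - A4 * b \<and> A4 ^ 4 = A3 ^ 4)"
      using even_sum_of_two_powers[of A3 B3 A4 B4] z n34 unfolding defs by blast
    note eq0 = eqs(9)
    have P: "P2 = P4 * b\<^sup>2" "P0 = P4 * b ^ 4"
      if "B1 = A1 * b" "B2 = - A2 * b" "A2 ^ 4 = A1 ^ 4" for b
      using that unfolding P2_def P4_def P0_def by algebra+
    have Q: "Q2 = - P4 * b\<^sup>2" "Q0 = - P4 * b ^ 4"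
      if "B3 = A3 * b" "B4 = - A4 * b" "A4 ^ 4 = A3 ^ 4" for b
      using that Q4 unfolding Q2_def Q4_def Q0_def by algebra+
    have P_I: "P2 = 0" if "A1 = 0 \<and> B2 = 0 \<or> A2 = 0 \<and> B1 = 0"
      using that unfolding P2_def by auto
    have Q_I: "Q2 = 0" if "A3 = 0 \<and> B4 = 0 \<or> A4 = 0 \<and> B3 = 0"
      using that unfolding Q2_def by auto
    \<comment> \<open>\<open>C\<^sub>4 \<noteq> 0\<close> leaves \<open>\<gamma>'/\<gamma> = - 1\<close> or \<open>\<plusminus>\<i>\<close>. In the latter case \<open>C\<^sub>2 = 0\<close> determines both quartics
      up to scalars, and then \<open>C\<^sub>0 + C'\<^sub>0 = - (28/9)\<gamma>\<^sup>2P\<^sub>4\<close>.\<close>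
    have "\<gamma> + \<gamma>' = 0"
    proof (rule ccontr)
      assume n: "\<gamma> + \<gamma>' \<noteq> 0"
      then have g: "\<gamma>'\<^sup>2 = - (\<gamma>\<^sup>2)" using four neq P4 by (auto simp: eq_neg_iff_add_eq_0 add.commute)
      have e: "3 * P2 + 2 * \<gamma> * P4 = 0" "3 * Q2 + 2 * \<gamma>' * Q4 = 0" using two n neq by auto
      have "P2 \<noteq> 0" "Q2 \<noteq> 0" using e P4 Q4 nz by auto
      then obtain b b' where b: "B1 = A1 * b" "B2 = - A2 * b" "A2 ^ 4 = A1 ^ 4"
          "B3 = A3 * b'" "B4 = - A4 * b'" "A4 ^ 4 = A3 ^ 4"
        using T12 T34 P_I Q_I by blast
      have "28 * (P4 * \<gamma>\<^sup>2) = 0"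
        using e eq0 g Q4 P4 P[OF b(1-3)] Q[OF b(4-6)] by algebra
      then show False using P4 nz by simp
    qed
    then have g: "\<gamma>' = - \<gamma>" by (simp add: eq_neg_iff_add_eq_0 add.commute)
    have e2: "3 * P2 + 3 * Q2 + 4 * \<gamma> * P4 = 0"
      using eqs(5) Q4 g by algebra
    have e0: "P0 + Q0 + 12 * \<gamma> * (P2 - Q2) = 0"
      using eq0 Q4 g by algebra
    consider (I_I) "A1 = 0 \<and> B2 = 0 \<or> A2 = 0 \<and> B1 = 0" "A3 = 0 \<and> B4 = 0 \<or> A4 = 0 \<and> B3 = 0"
      | (I_II) b where "A1 = 0 \<and> B2 = 0 \<and> A2 \<noteq> 0 \<and> B1 \<noteq> 0 \<or> A2 = 0 \<and> B1 = 0 \<and> A1 \<noteq> 0 \<and> B2 \<noteq> 0"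
         "A3 \<noteq> 0" "A4 \<noteq> 0" "B3 = A3 * b" "B4 = - A4 * b" "A4 ^ 4 = A3 ^ 4"
      | (II_I) b where "A3 = 0 \<and> B4 = 0 \<and> A4 \<noteq> 0 \<and> B3 \<noteq> 0 \<or> A4 = 0 \<and> B3 = 0 \<and> A3 \<noteq> 0 \<and> B4 \<noteq> 0"
         "A1 \<noteq> 0" "A2 \<noteq> 0" "B1 = A1 * b" "B2 = - A2 * b" "A2 ^ 4 = A1 ^ 4"
      | (II_II) b b' where "A1 \<noteq> 0" "A2 \<noteq> 0" "B1 = A1 * b" "B2 = - A2 * b" "A2 ^ 4 = A1 ^ 4"
         "A3 \<noteq> 0" "A4 \<noteq> 0" "B3 = A3 * b'" "B4 = - A4 * b'" "A4 ^ 4 = A3 ^ 4"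
      using T12 T34 by blast
    then show ?thesis
    proof cases
      case I_I
      then have "4 * \<gamma> * P4 = 0" using e2 P_I Q_I by simp
      then show ?thesis using nz P4 by simp
    next
      case I_II
      have "P2 = 0" using P_I I_II(1) by blast
      then have "P4 * (3 * b\<^sup>2 - 4 * \<gamma>) = 0" using e2 Q[OF I_II(4-6)] by algebra
      then have b: "b\<^sup>2 = 4 * \<gamma> / 3" using P4 by (simp add: field_simps)
      have "first_kind ?S"
        using I_II(1)
      proof (elim disjE conjE)
        assume "A1 = 0" "B2 = 0" "A2 \<noteq> 0" "B1 \<noteq> 0"
        then show ?thesis
          using first_kind_opposite_pencils[OF b nz(1), of B1 A2 A3 A4] I_II g by simp
      next
        assume "A2 = 0" "B1 = 0" "A1 \<noteq> 0" "B2 \<noteq> 0"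
        then show ?thesis
          using first_kind_opposite_pencils[OF b nz(1), of B2 A1 A3 A4] I_II g by (simp add: insert_commute)
      qed
      then show ?thesis ..
    next
      case II_I
      have "Q2 = 0" using Q_I II_I(1) by blast
      then have "P4 * (3 * b\<^sup>2 - 4 * \<gamma>') = 0" using e2 g P[OF II_I(4-6)] by algebra
      then have b: "b\<^sup>2 = 4 * \<gamma>' / 3" using P4 by (simp add: field_simps)
      have S: "?S = {qform A3 B3 (A3 * \<gamma>'), qform A4 B4 (A4 * \<gamma>'),
          qform A1 (A1 * b) (- A1 * \<gamma>'), qform A2 (- A2 * b) (- A2 * \<gamma>')}"
        using II_I g by auto
      have "first_kind ?S"
        using II_I(1)
      proof (elim disjE conjE)
        assume "A3 = 0" "B4 = 0" "A4 \<noteq> 0" "B3 \<noteq> 0"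
        then show ?thesis
          using first_kind_opposite_pencils[OF b nz(2), of B3 A4 A1 A2] II_I(2,3) unfolding S by simp
      next
        assume "A4 = 0" "B3 = 0" "A3 \<noteq> 0" "B4 \<noteq> 0"
        then show ?thesis
          using first_kind_opposite_pencils[OF b nz(2), of B4 A3 A1 A2] II_I(2,3) unfolding S
          by (simp add: insert_commute)
      qed
      then show ?thesis ..
    next
      case II_II
      note P = P[OF II_II(3-5)] and Q = Q[OF II_II(8-10)]
      have "P4 * (3 * b\<^sup>2 - 3 * b'\<^sup>2 + 4 * \<gamma>) = 0" using e2 P Q by algebra
      then have d: "3 * b\<^sup>2 - 3 * b'\<^sup>2 + 4 * \<gamma> = 0" using P4 by simp
      \<comment> \<open>\<open>C\<^sub>0 + C'\<^sub>0\<close> is \<open>P\<^sub>4(b\<^sup>2 + b'\<^sup>2)(b\<^sup>2 - b'\<^sup>2 + 12\<gamma>)\<close>, and the last factor equals \<open>(32/3)\<gamma>\<close> by \<open>d\<close>.\<close>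
      have "32 * (P4 * (\<gamma> * (b\<^sup>2 + b'\<^sup>2))) = 0" using e0 P Q d by algebra
      then have "b\<^sup>2 + b'\<^sup>2 = 0" using P4 nz by simp
      then have "b'\<^sup>2 = - (b\<^sup>2)" "3 * b\<^sup>2 = - 2 * \<gamma>" using d by algebra+
      then have "second_kind {qform A1 (A1 * b) (A1 * \<gamma>), qform A2 (- A2 * b) (A2 * \<gamma>),
         qform A3 (A3 * b') (- A3 * \<gamma>), qform A4 (- A4 * b') (- A4 * \<gamma>)}"
        using second_kind_opposite_pencils nz II_II by blast
      then show ?thesis using II_II g by simp
    qed
  qed
qed

section \<open>Two pencils with a common member\<close>

lemma colinear_multiple:
  fixes a b a' b' :: complex
  assumes "a * b' = a' * b" "a \<noteq> 0 \<or> b \<noteq> 0"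
  shows "\<exists>k. a' = k * a \<and> b' = k * b"
proof (cases "a = 0")
  case True
  then show ?thesis using assms by (intro exI[of _ "b' / b"]) auto
next
  case False
  then show ?thesis using assms by (intro exI[of _ "a' / a"]) (auto simp: field_simps)
qed

text \<open>
  If the pencils coincide, all four forms are linear in \<open>xy\<close> and one further form. If one of \<open>\<alpha>\<close>, \<open>\<gamma>\<close>,
  \<open>\<alpha>'\<close>, \<open>\<gamma>'\<close> vanishes, the coefficients near the corresponding end of the octic on the other side
  vanish too, against \<open>proportional_if_degree_small\<close>. Otherwise scaling the generators gives the
  normalised case.
\<close>

lemma pencils_through_xy:
  fixes A1 A2 A3 A4 B1 B2 B3 B4 \<alpha> \<alpha>' \<gamma> \<gamma>' :: complex
  assumes n12: "A1 * B2 \<noteq> A2 * B1" and n34: "A3 * B4 \<noteq> A4 * B3"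
    and ind: "independent_pair (qform (A1 * \<alpha>) B1 (A1 * \<gamma>)) (qform (A2 * \<alpha>) B2 (A2 * \<gamma>))"
      "independent_pair (qform (A1 * \<alpha>) B1 (A1 * \<gamma>)) (qform (A3 * \<alpha>') B3 (A3 * \<gamma>'))"
      "independent_pair (qform (A1 * \<alpha>) B1 (A1 * \<gamma>)) (qform (A4 * \<alpha>') B4 (A4 * \<gamma>'))"
      "independent_pair (qform (A3 * \<alpha>') B3 (A3 * \<gamma>')) (qform (A4 * \<alpha>') B4 (A4 * \<gamma>'))"
    and eq: "\<And>x. (A1 * \<alpha> * x\<^sup>2 + B1 * x + A1 * \<gamma>) ^ 4 + (A2 * \<alpha> * x\<^sup>2 + B2 * x + A2 * \<gamma>) ^ 4
      + (A3 * \<alpha>' * x\<^sup>2 + B3 * x + A3 * \<gamma>') ^ 4 + (A4 * \<alpha>' * x\<^sup>2 + B4 * x + A4 * \<gamma>') ^ 4 = 0"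
  shows "first_kind {qform (A1 * \<alpha>) B1 (A1 * \<gamma>), qform (A2 * \<alpha>) B2 (A2 * \<gamma>),
        qform (A3 * \<alpha>') B3 (A3 * \<gamma>'), qform (A4 * \<alpha>') B4 (A4 * \<gamma>')} \<or>
      second_kind {qform (A1 * \<alpha>) B1 (A1 * \<gamma>), qform (A2 * \<alpha>) B2 (A2 * \<gamma>),
        qform (A3 * \<alpha>') B3 (A3 * \<gamma>'), qform (A4 * \<alpha>') B4 (A4 * \<gamma>')}"
proof -
  note cs = power4_sum_coeffs_unweighted[OF eq]
  note c = cs[of 0] cs[of 1] cs[of 2] cs[of 3] cs[of 4] cs[of 5] cs[of 6] cs[of 7] cs[of 8]
  note c = c[simplified, unfolded power4_coeff[simplified]]
  have nz: "\<alpha> \<noteq> 0 \<or> \<gamma> \<noteq> 0" "\<alpha>' \<noteq> 0 \<or> \<gamma>' \<noteq> 0"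
    using ind(1,4) unfolding independent_qform_iff by auto
  have noncol: "\<alpha> * \<gamma>' \<noteq> \<alpha>' * \<gamma>"
  proof
    assume "\<alpha> * \<gamma>' = \<alpha>' * \<gamma>"
    then obtain k where k: "\<alpha>' = k * \<alpha>" "\<gamma>' = k * \<gamma>" using colinear_multiple nz by blast
    define C3 where "C3 = A3 * k"
    define C4 where "C4 = A4 * k"
    have e: "A3 * \<alpha>' = C3 * \<alpha>" "A3 * \<gamma>' = C3 * \<gamma>" "A4 * \<alpha>' = C4 * \<alpha>" "A4 * \<gamma>' = C4 * \<gamma>"
      by (simp_all add: k C3_def C4_def)
    note c = c[unfolded e]
    have n: "A1 * B3 \<noteq> C3 * B1" "A1 * B4 \<noteq> C4 * B1"
      using ind(2,3) unfolding e independent_qform_iff by (auto simp: algebra_simps)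
    have E4: "A1 ^ 4 + A2 ^ 4 + C3 ^ 4 + C4 ^ 4 = 0"
    proof -
      have "\<alpha> ^ 4 * (A1 ^ 4 + A2 ^ 4 + C3 ^ 4 + C4 ^ 4) = 0"
        "\<gamma> ^ 4 * (A1 ^ 4 + A2 ^ 4 + C3 ^ 4 + C4 ^ 4) = 0" using c by algebra+
      then show ?thesis using nz by auto
    qed
    have E3: "A1 ^ 3 * B1 + A2 ^ 3 * B2 + C3 ^ 3 * B3 + C4 ^ 3 * B4 = 0"
    proof -
      have "\<alpha> ^ 3 * (A1 ^ 3 * B1 + A2 ^ 3 * B2 + C3 ^ 3 * B3 + C4 ^ 3 * B4) = 0"
        "\<gamma> ^ 3 * (A1 ^ 3 * B1 + A2 ^ 3 * B2 + C3 ^ 3 * B3 + C4 ^ 3 * B4) = 0" using c by algebra+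
      then show ?thesis using nz by auto
    qed
    have E2: "A1\<^sup>2 * B1\<^sup>2 + A2\<^sup>2 * B2\<^sup>2 + C3\<^sup>2 * B3\<^sup>2 + C4\<^sup>2 * B4\<^sup>2 = 0"
    proof -
      have "\<alpha>\<^sup>2 * (A1\<^sup>2 * B1\<^sup>2 + A2\<^sup>2 * B2\<^sup>2 + C3\<^sup>2 * B3\<^sup>2 + C4\<^sup>2 * B4\<^sup>2) = 0"
        "\<gamma>\<^sup>2 * (A1\<^sup>2 * B1\<^sup>2 + A2\<^sup>2 * B2\<^sup>2 + C3\<^sup>2 * B3\<^sup>2 + C4\<^sup>2 * B4\<^sup>2) = 0" using c E4 by algebra+
      then show ?thesis using nz by auto
    qed
    have E1: "A1 * B1 ^ 3 + A2 * B2 ^ 3 + C3 * B3 ^ 3 + C4 * B4 ^ 3 = 0"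
    proof -
      have "\<alpha> * (A1 * B1 ^ 3 + A2 * B2 ^ 3 + C3 * B3 ^ 3 + C4 * B4 ^ 3) = 0"
        "\<gamma> * (A1 * B1 ^ 3 + A2 * B2 ^ 3 + C3 * B3 ^ 3 + C4 * B4 ^ 3) = 0" using c E3 by algebra+
      then show ?thesis using nz by auto
    qed
    have E0: "B1 ^ 4 + B2 ^ 4 + B3 ^ 4 + B4 ^ 4 = 0" using c E4 E2 by algebra
    show False using four_linear_forms[OF n12 n E4 E3 E2 E1 E0] .
  qed
  have "\<alpha> \<noteq> 0"
  proof
    assume z: "\<alpha> = 0"
    then have "\<alpha>' \<noteq> 0" using noncol by auto
    moreover have "\<alpha>' ^ 4 * (A3 ^ 4 + A4 ^ 4) = 0" "\<alpha>' ^ 3 * (A3 ^ 3 * B3 + A4 ^ 3 * B4) = 0"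
      using c z by algebra+
    ultimately show False using proportional_if_degree_small[of A3 A4 B3 B4] n34 by simp
  qed
  moreover have "\<gamma> \<noteq> 0"
  proof
    assume z: "\<gamma> = 0"
    then have "\<gamma>' \<noteq> 0" using noncol by auto
    moreover have "\<gamma>' ^ 4 * (A3 ^ 4 + A4 ^ 4) = 0" "\<gamma>' ^ 3 * (A3 ^ 3 * B3 + A4 ^ 3 * B4) = 0"
      using c z by algebra+
    ultimately show False using proportional_if_degree_small[of A3 A4 B3 B4] n34 by simp
  qed
  moreover have "\<alpha>' \<noteq> 0"
  proof
    assume z: "\<alpha>' = 0"
    then have "\<alpha> \<noteq> 0" using noncol by auto
    moreover have "\<alpha> ^ 4 * (A1 ^ 4 + A2 ^ 4) = 0" "\<alpha> ^ 3 * (A1 ^ 3 * B1 + A2 ^ 3 * B2) = 0"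
      using c z by algebra+
    ultimately show False using proportional_if_degree_small[of A1 A2 B1 B2] n12 by simp
  qed
  moreover have "\<gamma>' \<noteq> 0"
  proof
    assume z: "\<gamma>' = 0"
    then have "\<gamma> \<noteq> 0" using noncol by auto
    moreover have "\<gamma> ^ 4 * (A1 ^ 4 + A2 ^ 4) = 0" "\<gamma> ^ 3 * (A1 ^ 3 * B1 + A2 ^ 3 * B2) = 0"
      using c z by algebra+
    ultimately show False using proportional_if_degree_small[of A1 A2 B1 B2] n12 by simp
  qed
  ultimately have nz': "\<alpha> \<noteq> 0" "\<gamma> \<noteq> 0" "\<alpha>' \<noteq> 0" "\<gamma>' \<noteq> 0" by auto
  define r r' where "r = \<gamma> / \<alpha>" and "r' = \<gamma>' / \<alpha>'"
  have e: "A1 * \<gamma> = A1 * \<alpha> * r" "A2 * \<gamma> = A2 * \<alpha> * r" "A3 * \<gamma>' = A3 * \<alpha>' * r'" "A4 * \<gamma>' = A4 * \<alpha>' * r'"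
    using nz' by (simp_all add: r_def r'_def)
  show ?thesis unfolding e
  proof (rule pencils_through_xy_normalised)
    show "r \<noteq> 0" "r' \<noteq> 0" "r \<noteq> r'" using nz' noncol by (auto simp: r_def r'_def field_simps)
    show "A1 * \<alpha> * B2 \<noteq> A2 * \<alpha> * B1" "A3 * \<alpha>' * B4 \<noteq> A4 * \<alpha>' * B3" using n12 n34 nz' by auto
  qed (rule eq[unfolded e])
qed

text \<open>
  In the affine coordinate \<open>x\<close> (\<open>y = 1\<close>) the two sides are polynomials of degree 3 or 4 in
  \<open>\<alpha>x\<^sup>2 + \<beta>x\<close>, respectively \<open>\<alpha>'x\<^sup>2 + \<beta>'x\<close>. If just one of \<open>\<alpha>\<close> and \<open>\<alpha>'\<close> vanishes, their degrees in \<open>x\<close>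
  differ. Otherwise the pencils coincide: if neither vanishes, the two top coefficients determine the
  ratios \<open>\<beta>/\<alpha>\<close> and \<open>\<beta>'/\<alpha>'\<close>, which therefore agree. Then \<open>four_linear_forms\<close> applies.
\<close>

lemma pencils_through_yy:
  fixes A1 A2 A3 A4 B1 B2 B3 B4 \<alpha> \<alpha>' \<beta> \<beta>' :: complex
  assumes n12: "A1 * B2 \<noteq> A2 * B1" and n34: "A3 * B4 \<noteq> A4 * B3"
    and ind: "independent_pair (qform (A1 * \<alpha>) (A1 * \<beta>) B1) (qform (A2 * \<alpha>) (A2 * \<beta>) B2)"
      "independent_pair (qform (A1 * \<alpha>) (A1 * \<beta>) B1) (qform (A3 * \<alpha>') (A3 * \<beta>') B3)"
      "independent_pair (qform (A1 * \<alpha>) (A1 * \<beta>) B1) (qform (A4 * \<alpha>') (A4 * \<beta>') B4)"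
    and eq: "\<And>x. (A1 * \<alpha> * x\<^sup>2 + A1 * \<beta> * x + B1) ^ 4 + (A2 * \<alpha> * x\<^sup>2 + A2 * \<beta> * x + B2) ^ 4
      + (A3 * \<alpha>' * x\<^sup>2 + A3 * \<beta>' * x + B3) ^ 4 + (A4 * \<alpha>' * x\<^sup>2 + A4 * \<beta>' * x + B4) ^ 4 = 0"
  shows False
proof -
  note cs = power4_sum_coeffs_unweighted[OF eq]
  note c = cs[of 0] cs[of 1] cs[of 2] cs[of 3] cs[of 4] cs[of 5] cs[of 6] cs[of 7] cs[of 8]
  note c = c[simplified, unfolded power4_coeff[simplified]]
  have nz: "\<alpha> \<noteq> 0 \<or> \<beta> \<noteq> 0"
    using ind(1) unfolding independent_qform_iff by auto
  have noncol: "\<alpha> * \<beta>' \<noteq> \<alpha>' * \<beta>"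
  proof
    assume "\<alpha> * \<beta>' = \<alpha>' * \<beta>"
    then obtain k where k: "\<alpha>' = k * \<alpha>" "\<beta>' = k * \<beta>" using colinear_multiple nz by blast
    define C3 where "C3 = A3 * k"
    define C4 where "C4 = A4 * k"
    have e: "A3 * \<alpha>' = C3 * \<alpha>" "A3 * \<beta>' = C3 * \<beta>" "A4 * \<alpha>' = C4 * \<alpha>" "A4 * \<beta>' = C4 * \<beta>"
      by (simp_all add: k C3_def C4_def)
    note c = c[unfolded e]
    have n: "A1 * B3 \<noteq> C3 * B1" "A1 * B4 \<noteq> C4 * B1"
      using ind(2,3) unfolding e independent_qform_iff by (auto simp: algebra_simps)
    have E4: "A1 ^ 4 + A2 ^ 4 + C3 ^ 4 + C4 ^ 4 = 0"
    proof (cases "\<alpha> = 0")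
      case False
      have "\<alpha> ^ 4 * (A1 ^ 4 + A2 ^ 4 + C3 ^ 4 + C4 ^ 4) = 0" using c by algebra
      then show ?thesis using False by simp
    next
      case True
      have "\<beta> ^ 4 * (A1 ^ 4 + A2 ^ 4 + C3 ^ 4 + C4 ^ 4) = 0" using c True by algebra
      then show ?thesis using True nz by simp
    qed
    have E3: "A1 ^ 3 * B1 + A2 ^ 3 * B2 + C3 ^ 3 * B3 + C4 ^ 3 * B4 = 0"
    proof (cases "\<alpha> = 0")
      case False
      have "\<alpha> ^ 3 * (A1 ^ 3 * B1 + A2 ^ 3 * B2 + C3 ^ 3 * B3 + C4 ^ 3 * B4) = 0" using c E4 by algebra
      then show ?thesis using False by simp
    next
      case True
      have "\<beta> ^ 3 * (A1 ^ 3 * B1 + A2 ^ 3 * B2 + C3 ^ 3 * B3 + C4 ^ 3 * B4) = 0" using c True by algebra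
      then show ?thesis using True nz by simp
    qed
    have E2: "A1\<^sup>2 * B1\<^sup>2 + A2\<^sup>2 * B2\<^sup>2 + C3\<^sup>2 * B3\<^sup>2 + C4\<^sup>2 * B4\<^sup>2 = 0"
    proof (cases "\<alpha> = 0")
      case False
      have "\<alpha>\<^sup>2 * (A1\<^sup>2 * B1\<^sup>2 + A2\<^sup>2 * B2\<^sup>2 + C3\<^sup>2 * B3\<^sup>2 + C4\<^sup>2 * B4\<^sup>2) = 0" using c E4 E3 by algebra
      then show ?thesis using False by simp
    next
      case True
      have "\<beta>\<^sup>2 * (A1\<^sup>2 * B1\<^sup>2 + A2\<^sup>2 * B2\<^sup>2 + C3\<^sup>2 * B3\<^sup>2 + C4\<^sup>2 * B4\<^sup>2) = 0" using c True by algebra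
      then show ?thesis using True nz by simp
    qed
    have E1: "A1 * B1 ^ 3 + A2 * B2 ^ 3 + C3 * B3 ^ 3 + C4 * B4 ^ 3 = 0"
    proof (cases "\<alpha> = 0")
      case False
      have "\<alpha> * (A1 * B1 ^ 3 + A2 * B2 ^ 3 + C3 * B3 ^ 3 + C4 * B4 ^ 3) = 0" using c E2 by algebra
      then show ?thesis using False by simp
    next
      case True
      have "\<beta> * (A1 * B1 ^ 3 + A2 * B2 ^ 3 + C3 * B3 ^ 3 + C4 * B4 ^ 3) = 0" using c True by algebra
      then show ?thesis using True nz by simp
    qed
    have E0: "B1 ^ 4 + B2 ^ 4 + B3 ^ 4 + B4 ^ 4 = 0" using c by algebra
    show False using four_linear_forms[OF n12 n E4 E3 E2 E1 E0] .
  qed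
  have a: "\<alpha> \<noteq> 0"
  proof
    assume z: "\<alpha> = 0"
    then have "\<alpha>' \<noteq> 0" using noncol by auto
    moreover have q4: "\<alpha>' ^ 4 * (A3 ^ 4 + A4 ^ 4) = 0" using c z by algebra
    moreover have "\<alpha>' ^ 3 * (A3 ^ 3 * B3 + A4 ^ 3 * B4) = 0"
    proof -
      have "A3 ^ 4 + A4 ^ 4 = 0" using q4 \<open>\<alpha>' \<noteq> 0\<close> by simp
      then show ?thesis using c z by algebra
    qed
    ultimately show False using proportional_if_degree_small[of A3 A4 B3 B4] n34 by simp
  qed
  have "\<alpha> ^ 3 * (\<alpha> * \<beta>' - \<alpha>' * \<beta>) * (A1 ^ 4 + A2 ^ 4) = 0" using c by algebra
  then have p4: "A1 ^ 4 + A2 ^ 4 = 0" using a noncol by simp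
  have q4: "\<alpha>' = 0 \<or> A3 ^ 4 + A4 ^ 4 = 0"
  proof -
    have "\<alpha>' ^ 4 * (A3 ^ 4 + A4 ^ 4) = 0" using c p4 by algebra
    then show ?thesis by simp
  qed
  then have "\<alpha>\<^sup>2 * (\<alpha> * \<beta>' - \<alpha>' * \<beta>) * (A1 ^ 3 * B1 + A2 ^ 3 * B2) = 0"
  proof
    assume "\<alpha>' = 0"
    then have "\<alpha> ^ 3 * (A1 ^ 3 * B1 + A2 ^ 3 * B2) = 0" using c p4 by algebra
    then show ?thesis using a by simp
  next
    assume "A3 ^ 4 + A4 ^ 4 = 0"
    then show ?thesis using c p4 by algebra
  qed
  then have "A1 ^ 3 * B1 + A2 ^ 3 * B2 = 0" using a noncol by simp
  then show False using proportional_if_degree_small[of A1 A2 B1 B2] p4 n12 by simp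
qed

text \<open>
  Cramer's rule if the first three vectors are independent. Otherwise the third is a combination of
  the first two, with the \<open>2 \<times> 2\<close> minors of these as coefficients.
\<close>

lemma linear_relation:
  fixes a1 a2 a3 a4 :: complex
  assumes "a1 * b2 \<noteq> a2 * b1 \<or> a1 * c2 \<noteq> a2 * c1 \<or> b1 * c2 \<noteq> b2 * c1"
  shows "\<exists>e1 e2 e3 e4. (e3 \<noteq> 0 \<or> e4 \<noteq> 0) \<and> e1 * a1 + e2 * a2 + e3 * a3 + e4 * a4 = 0
    \<and> e1 * b1 + e2 * b2 + e3 * b3 + e4 * b4 = 0 \<and> e1 * c1 + e2 * c2 + e3 * c3 + e4 * c4 = 0"
proof -
  define det where "det = (\<lambda>a b c a' b' c' a'' b'' c'' :: complex.
    a * (b' * c'' - b'' * c') - b * (a' * c'' - a'' * c') + c * (a' * b'' - a'' * b'))"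
  define d where "d = det a1 b1 c1 a2 b2 c2 a3 b3 c3"
  show ?thesis
  proof (cases "d = 0")
    case False
    have "det a4 b4 c4 a2 b2 c2 a3 b3 c3 * a1 + det a1 b1 c1 a4 b4 c4 a3 b3 c3 * a2
        + det a1 b1 c1 a2 b2 c2 a4 b4 c4 * a3 + - d * a4 = 0"
      "det a4 b4 c4 a2 b2 c2 a3 b3 c3 * b1 + det a1 b1 c1 a4 b4 c4 a3 b3 c3 * b2
        + det a1 b1 c1 a2 b2 c2 a4 b4 c4 * b3 + - d * b4 = 0"
      "det a4 b4 c4 a2 b2 c2 a3 b3 c3 * c1 + det a1 b1 c1 a4 b4 c4 a3 b3 c3 * c2
        + det a1 b1 c1 a2 b2 c2 a4 b4 c4 * c3 + - d * c4 = 0"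
      by (simp_all add: d_def det_def algebra_simps)
    then show ?thesis using False by (metis neg_equal_0_iff_equal)
  next
    case True
    have "(a2 * b3 - a3 * b2) * a1 + (a3 * b1 - a1 * b3) * a2 + (a1 * b2 - a2 * b1) * a3 + 0 * a4 = 0"
      "(a2 * b3 - a3 * b2) * b1 + (a3 * b1 - a1 * b3) * b2 + (a1 * b2 - a2 * b1) * b3 + 0 * b4 = 0"
      "(a2 * b3 - a3 * b2) * c1 + (a3 * b1 - a1 * b3) * c2 + (a1 * b2 - a2 * b1) * c3 + 0 * c4 = d"
      "(a2 * c3 - a3 * c2) * a1 + (a3 * c1 - a1 * c3) * a2 + (a1 * c2 - a2 * c1) * a3 + 0 * a4 = 0"
      "(a2 * c3 - a3 * c2) * b1 + (a3 * c1 - a1 * c3) * b2 + (a1 * c2 - a2 * c1) * b3 + 0 * b4 = - d"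
      "(a2 * c3 - a3 * c2) * c1 + (a3 * c1 - a1 * c3) * c2 + (a1 * c2 - a2 * c1) * c3 + 0 * c4 = 0"
      "(b2 * c3 - b3 * c2) * a1 + (b3 * c1 - b1 * c3) * a2 + (b1 * c2 - b2 * c1) * a3 + 0 * a4 = d"
      "(b2 * c3 - b3 * c2) * b1 + (b3 * c1 - b1 * c3) * b2 + (b1 * c2 - b2 * c1) * b3 + 0 * b4 = 0"
      "(b2 * c3 - b3 * c2) * c1 + (b3 * c1 - b1 * c3) * c2 + (b1 * c2 - b2 * c1) * c3 + 0 * c4 = 0"
      by (simp_all add: d_def det_def algebra_simps)
    then show ?thesis using assms True by (metis neg_equal_0_iff_equal right_minus_eq)
  qed
qed

lemma kernel_multiple:
  fixes e1 e2 a1 a2 :: complex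
  assumes "e1 * a1 + e2 * a2 = 0" "e1 \<noteq> 0 \<or> e2 \<noteq> 0"
  shows "\<exists>k. a1 = e2 * k \<and> a2 = - e1 * k"
proof -
  have "e2 * a2 = (- e1) * a1" using assms(1) by (simp add: eq_neg_iff_add_eq_0 add.commute)
  then have "\<exists>k. a1 = k * e2 \<and> a2 = k * (- e1)"
    using colinear_multiple[of e2 a2 a1 "- e1"] assms(2) by (auto simp: mult.commute)
  then show ?thesis by (auto simp: mult.commute)
qed

text \<open>
  Let \<open>h = e\<^sub>1f\<^sub>1 + e\<^sub>2f\<^sub>2 = - e\<^sub>3f\<^sub>3 - e\<^sub>4f\<^sub>4\<close> be the common member. When \<open>h\<close> is \<open>xy\<close>, the coefficients at \<open>x\<^sup>2\<close>
  of \<open>f\<^sub>1\<close> and \<open>f\<^sub>2\<close> are orthogonal to \<open>(e\<^sub>1, e\<^sub>2)\<close>, hence proportional to \<open>(e\<^sub>2, - e\<^sub>1)\<close>, and so are those at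
  \<open>y\<^sup>2\<close>. This is the shape that \<open>pencils_through_xy\<close> expects, with \<open>A\<^sub>1 = e\<^sub>2\<close>, \<open>A\<^sub>2 = - e\<^sub>1\<close> and
  \<open>A\<^sub>1B\<^sub>2 - A\<^sub>2B\<^sub>1 = 1\<close>, the coefficient of \<open>h\<close> at \<open>xy\<close>. The same works for \<open>y\<^sup>2\<close> and for \<open>f\<^sub>3\<close>, \<open>f\<^sub>4\<close>.
\<close>

lemma four_fourth_powers_classification:
  assumes q: "is_quadratic f1" "is_quadratic f2" "is_quadratic f3" "is_quadratic f4"
    and ind: "independent_pair f1 f2" "independent_pair f1 f3" "independent_pair f1 f4" "independent_pair f3 f4"
    and eq: "\<And>v. f1 v ^ 4 + f2 v ^ 4 + f3 v ^ 4 + f4 v ^ 4 = 0"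
  shows "first_kind {f1, f2, f3, f4} \<or> second_kind {f1, f2, f3, f4}"
proof -
  obtain a1 b1 c1 where f1: "f1 = qform a1 b1 c1" using q(1) unfolding is_quadratic_def by blast
  obtain a2 b2 c2 where f2: "f2 = qform a2 b2 c2" using q(2) unfolding is_quadratic_def by blast
  obtain a3 b3 c3 where f3: "f3 = qform a3 b3 c3" using q(3) unfolding is_quadratic_def by blast
  obtain a4 b4 c4 where f4: "f4 = qform a4 b4 c4" using q(4) unfolding is_quadratic_def by blast
  obtain e1 e2 e3 e4 where e34: "e3 \<noteq> 0 \<or> e4 \<noteq> 0" and rel:
    "e1 * a1 + e2 * a2 + e3 * a3 + e4 * a4 = 0" "e1 * b1 + e2 * b2 + e3 * b3 + e4 * b4 = 0"
    "e1 * c1 + e2 * c2 + e3 * c3 + e4 * c4 = 0"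
    using linear_relation[of a1 b2 a2 b1 c2 c1] ind(1) unfolding f1 f2 independent_qform_iff by metis
  define h where "h = fscale e1 f1 + fscale e2 f2"
  have h0: "fscale e3 f3 + fscale e4 f4 + h = 0"
    using rel unfolding h_def f1 f2 f3 f4 fscale_qform qform_add qform_eq_0_iff
    by (simp add: algebra_simps)
  have hnz: "h \<noteq> 0"
    using h0 ind(4) e34 unfolding independent_pair_def by force
  have e12: "e1 \<noteq> 0 \<or> e2 \<noteq> 0" using hnz unfolding h_def by (auto simp: fscale_def fun_eq_iff)
  have "is_quadratic h" unfolding h_def f1 f2 fscale_qform qform_add is_quadratic_def by blast
  then obtain L where L: "linear_change L" "h = qform 0 1 0 \<circ> L \<or> h = qform 0 0 1 \<circ> L"
    using quadratic_normal_form hnz by blast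
  obtain N where N: "linear_change N" "L \<circ> N = id" "N \<circ> L = id"
    using linear_change_inverse[OF L(1)] by blast
  obtain p1 q1 r1 where F1: "f1 \<circ> N = qform p1 q1 r1"
    using is_quadratic_comp[OF q(1) N(1)] unfolding is_quadratic_def by blast
  obtain p2 q2 r2 where F2: "f2 \<circ> N = qform p2 q2 r2"
    using is_quadratic_comp[OF q(2) N(1)] unfolding is_quadratic_def by blast
  obtain p3 q3 r3 where F3: "f3 \<circ> N = qform p3 q3 r3"
    using is_quadratic_comp[OF q(3) N(1)] unfolding is_quadratic_def by blast
  obtain p4 q4 r4 where F4: "f4 \<circ> N = qform p4 q4 r4"
    using is_quadratic_comp[OF q(4) N(1)] unfolding is_quadratic_def by blast
  note ind' = ind[THEN independent_comp, OF N(1), unfolded F1 F2 F3 F4]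
  have eq': "(p1 * x\<^sup>2 + q1 * x + r1) ^ 4 + (p2 * x\<^sup>2 + q2 * x + r2) ^ 4
    + (p3 * x\<^sup>2 + q3 * x + r3) ^ 4 + (p4 * x\<^sup>2 + q4 * x + r4) ^ 4 = 0" for x
    using eq[of "N (x, 1)"] fun_cong[OF F1, of "(x, 1)"] fun_cong[OF F2, of "(x, 1)"]
      fun_cong[OF F3, of "(x, 1)"] fun_cong[OF F4, of "(x, 1)"] by (simp add: qform_apply)
  have hN: "h \<circ> N = qform (e1 * p1 + e2 * p2) (e1 * q1 + e2 * q2) (e1 * r1 + e2 * r2)"
  proof -
    have "h \<circ> N = fscale e1 (f1 \<circ> N) + fscale e2 (f2 \<circ> N)"
      unfolding h_def fscale_def plus_fun_def comp_def ..
    then show ?thesis unfolding F1 F2 fscale_qform qform_add .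
  qed
  have hN': "fscale (- 1) (h \<circ> N) = qform (e3 * p3 + e4 * p4) (e3 * q3 + e4 * q4) (e3 * r3 + e4 * r4)"
  proof -
    have "fscale (- 1) (h \<circ> N) = fscale e3 (f3 \<circ> N) + fscale e4 (f4 \<circ> N)"
    proof
      fix v
      show "fscale (- 1) (h \<circ> N) v = (fscale e3 (f3 \<circ> N) + fscale e4 (f4 \<circ> N)) v"
        using fun_cong[OF h0, of "N v"] by (simp add: fscale_def eq_neg_iff_add_eq_0 add.commute neg_eq_iff_add_eq_0)
    qed
    then show ?thesis unfolding F3 F4 fscale_qform qform_add .
  qed
  have qform_inj: "qform a b c = qform a' b' c' \<Longrightarrow> a = a' \<and> b = b' \<and> c = c'" for a b c a' b' c'
    using qform_eq_0_iff[of "a - a'" "b - b'" "c - c'"] by (simp flip: qform_diff)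
  consider (xy) "h \<circ> N = qform 0 1 0" | (yy) "h \<circ> N = qform 0 0 1"
    using L(2) N(2) by (metis comp_assoc comp_id)
  then have "first_kind {f1 \<circ> N, f2 \<circ> N, f3 \<circ> N, f4 \<circ> N} \<or> second_kind {f1 \<circ> N, f2 \<circ> N, f3 \<circ> N, f4 \<circ> N}"
  proof cases
    case xy
    have z: "e1 * p1 + e2 * p2 = 0" "e1 * r1 + e2 * r2 = 0" "e1 * q1 + e2 * q2 = 1"
      using qform_inj[OF hN[unfolded xy]] by auto
    have z': "e3 * p3 + e4 * p4 = 0" "e3 * r3 + e4 * r4 = 0" "e3 * q3 + e4 * q4 = - 1"
      using qform_inj[OF hN'[unfolded xy fscale_qform]] by auto
    obtain \<alpha> where a: "p1 = e2 * \<alpha>" "p2 = - e1 * \<alpha>" using kernel_multiple[OF z(1) e12] by blast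
    obtain \<gamma> where c: "r1 = e2 * \<gamma>" "r2 = - e1 * \<gamma>" using kernel_multiple[OF z(2) e12] by blast
    obtain \<alpha>' where a': "p3 = e4 * \<alpha>'" "p4 = - e3 * \<alpha>'" using kernel_multiple[OF z'(1) e34] by blast
    obtain \<gamma>' where c': "r3 = e4 * \<gamma>'" "r4 = - e3 * \<gamma>'" using kernel_multiple[OF z'(2) e34] by blast
    have "e2 * q2 \<noteq> - e1 * q1" using z(3) by (auto simp: algebra_simps)
    moreover have "e4 * q4 \<noteq> - e3 * q3" using z'(3) by (auto simp: algebra_simps)
    ultimately show ?thesis
      unfolding F1 F2 F3 F4 a c a' c'
      by (rule pencils_through_xy[OF _ _ ind'[unfolded a c a' c'] eq'[unfolded a c a' c']])
  next
    case yy
    have z: "e1 * p1 + e2 * p2 = 0" "e1 * q1 + e2 * q2 = 0" "e1 * r1 + e2 * r2 = 1"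
      using qform_inj[OF hN[unfolded yy]] by auto
    have z': "e3 * p3 + e4 * p4 = 0" "e3 * q3 + e4 * q4 = 0" "e3 * r3 + e4 * r4 = - 1"
      using qform_inj[OF hN'[unfolded yy fscale_qform]] by auto
    obtain \<alpha> where a: "p1 = e2 * \<alpha>" "p2 = - e1 * \<alpha>" using kernel_multiple[OF z(1) e12] by blast
    obtain \<beta> where c: "q1 = e2 * \<beta>" "q2 = - e1 * \<beta>" using kernel_multiple[OF z(2) e12] by blast
    obtain \<alpha>' where a': "p3 = e4 * \<alpha>'" "p4 = - e3 * \<alpha>'" using kernel_multiple[OF z'(1) e34] by blast
    obtain \<beta>' where c': "q3 = e4 * \<beta>'" "q4 = - e3 * \<beta>'" using kernel_multiple[OF z'(2) e34] by blast
    have "e2 * r2 \<noteq> - e1 * r1" using z(3) by (auto simp: algebra_simps)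
    moreover have "e4 * r4 \<noteq> - e3 * r3" using z'(3) by (auto simp: algebra_simps)
    ultimately have False
      by (rule pencils_through_yy[OF _ _ ind'(1-3)[unfolded a c a' c'] eq'[unfolded a c a' c']])
    then show ?thesis ..
  qed
  moreover have "(\<lambda>f. f \<circ> L) ` {f1 \<circ> N, f2 \<circ> N, f3 \<circ> N, f4 \<circ> N} = {f1, f2, f3, f4}"
    by (simp add: comp_assoc N(3))
  ultimately show ?thesis using first_kind_comp[OF _ L(1)] second_kind_comp[OF _ L(1)] by metis
qed

section \<open>Dependent sets of fourth powers\<close>

text \<open>
  Choose coordinates in which \<open>y\<close> divides \<open>h\<close>. Then \<open>h\<^sup>4\<close> does not contribute to the coefficients of
  \<open>x\<^sup>8\<close>, \<open>x\<^sup>7y\<close> and \<open>x\<^sup>6y\<^sup>2\<close>, and if \<open>f\<close> and \<open>g\<close> had a nonzero leading coefficient, these would force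
  them to be proportional. So \<open>y\<close> divides all three forms, and the cofactors are three linear forms with
  dependent fourth powers.
\<close>

lemma three_fourth_powers:
  assumes q: "is_quadratic f" "is_quadratic g" "is_quadratic h"
    and ind: "independent_pair f g" "independent_pair f h" "independent_pair g h"
    and k: "k1 \<noteq> 0" "k2 \<noteq> 0"
    and eq: "\<And>v. k1 * f v ^ 4 + k2 * g v ^ 4 + k3 * h v ^ 4 = 0"
  shows False
proof -
  obtain L where L: "linear_change L" "h = qform 0 1 0 \<circ> L \<or> h = qform 0 0 1 \<circ> L"
    using quadratic_normal_form[OF q(3)] independent_nonzero[OF ind(2)] by blast
  obtain N where N: "linear_change N" "L \<circ> N = id" "N \<circ> L = id"
    using linear_change_inverse[OF L(1)] by blast
  obtain b3 c3 where h: "h \<circ> N = qform 0 b3 c3"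
    using L(2) N(2) by (metis comp_assoc comp_id)
  obtain a1 b1 c1 where f: "f \<circ> N = qform a1 b1 c1"
    using is_quadratic_comp[OF q(1) N(1)] unfolding is_quadratic_def by blast
  obtain a2 b2 c2 where g: "g \<circ> N = qform a2 b2 c2"
    using is_quadratic_comp[OF q(2) N(1)] unfolding is_quadratic_def by blast
  note ind' = ind[THEN independent_comp, OF N(1), unfolded f g h independent_qform_iff]
  have "k1 * (a1 * x\<^sup>2 + b1 * x + c1) ^ 4 + k2 * (a2 * x\<^sup>2 + b2 * x + c2) ^ 4
    + k3 * (0 * x\<^sup>2 + b3 * x + c3) ^ 4 + 0 * (0 * x\<^sup>2 + 0 * x + 0) ^ 4 = 0" for x
    using eq[of "N (x, 1)"] fun_cong[OF f, of "(x, 1)"] fun_cong[OF g, of "(x, 1)"]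
      fun_cong[OF h, of "(x, 1)"] by (simp add: qform_apply)
  note cs = power4_sum_coeffs[OF this]
  note c = cs[of 0] cs[of 1] cs[of 2] cs[of 3] cs[of 4] cs[of 5] cs[of 6] cs[of 7] cs[of 8]
  note c = c[simplified, unfolded power4_coeff[simplified], simplified]
  have a1: "a1 = 0"
  proof (rule ccontr)
    assume a1: "a1 \<noteq> 0"
    have a2: "a2 \<noteq> 0" using c k a1 by auto
    have "k2 * (a2 ^ 3 * (a2 * b1 - a1 * b2)) = 0" using c by algebra
    then have b: "a2 * b1 = a1 * b2" using a2 k by simp
    define t where "t = b1 / a1"
    have b1: "b1 = t * a1" using a1 by (simp add: t_def)
    have b2: "b2 = t * a2" using a1 b unfolding b1 by (simp add: mult.commute)
    \<comment> \<open>The terms of the coefficient at \<open>x\<^sup>6y\<^sup>2\<close> without \<open>c1\<close>, \<open>c2\<close> now add up to a multiple of the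
      coefficient at \<open>x\<^sup>8\<close>, which is zero.\<close>
    have "k2 * (a2 ^ 3 * (a2 * c1 - a1 * c2)) = 0" using c unfolding b1 b2 by algebra
    then have "a2 * c1 = a1 * c2" using a2 k by simp
    then show False using ind'(1) b a1 unfolding b1 b2 by (auto simp: algebra_simps)
  qed
  then have a2: "a2 = 0" using c k by auto
  \<comment> \<open>Apolarity again: the quartics \<open>b\<^sup>2(bc\<^sub>2 - b\<^sub>2c)(bc\<^sub>3 - b\<^sub>3c)\<close> and \<open>c\<^sup>2(bc\<^sub>2 - b\<^sub>2c)(bc\<^sub>3 - b\<^sub>3c)\<close> vanish at the
    second and third linear form.\<close>
  have "k1 * (b1\<^sup>2 * ((b1 * c2 - b2 * c1) * (b1 * c3 - b3 * c1))) = 0"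
    "k1 * (c1\<^sup>2 * ((b1 * c2 - b2 * c1) * (b1 * c3 - b3 * c1))) = 0"
    using c a1 a2 by algebra+
  then show False using ind'(1,2) k unfolding a1 a2 by auto
qed

text \<open>
  Since any three of the fourth powers are independent, all coefficients of the dependence are nonzero,
  and fourth roots of them can be absorbed into the forms.
\<close>

lemma W2_set_first_or_second_kind:
  assumes "W2_set 4 4 S"
  shows "first_kind S \<or> second_kind S"
proof -
  have fin: "finite S" and card: "card S = 4" and q: "\<And>f. f \<in> S \<Longrightarrow> is_quadratic f"
    and dep: "forms.dependent ((\<lambda>f. f ^ 4) ` S)"
    and nz: "\<And>f. f \<in> S \<Longrightarrow> f \<noteq> 0"
    and np: "\<And>f g. f \<in> S \<Longrightarrow> g \<in> S \<Longrightarrow> f \<noteq> g \<Longrightarrow> \<not> proportional f g"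
    using assms is_quadratic_if_binary_form unfolding W2_set_def honest_def pairwise_def by blast+
  have ind: "independent_pair f g" if "f \<in> S" "g \<in> S" "f \<noteq> g" for f g
    using nonproportional_independent np nz that by blast
  have no_three: False
    if T: "{f, g, h} \<subseteq> S" "f \<noteq> g" "f \<noteq> h" "g \<noteq> h" "k1 \<noteq> 0" "k2 \<noteq> 0"
      and eq: "\<And>v. k1 * f v ^ 4 + k2 * g v ^ 4 + k3 * h v ^ 4 = 0" for f g h k1 k2 k3
    by (rule three_fourth_powers[OF _ _ _ _ _ _ T(5,6) eq]) (use T q ind in auto)
  \<comment> \<open>Injectivity turns a dependence of the set of fourth powers into one indexed by \<open>S\<close>.\<close>
  have inj: "inj_on (\<lambda>f. f ^ 4) S"
  proof (rule inj_onI, rule ccontr)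
    fix f g assume fg: "f \<in> S" "g \<in> S" "f ^ 4 = g ^ 4" "f \<noteq> g"
    have "\<not> S \<subseteq> {f, g}" using card card_mono[of "{f, g}" S] fg(4) by auto
    then obtain h where "h \<in> S" "h \<noteq> f" "h \<noteq> g" by blast
    moreover have "1 * f v ^ 4 + - 1 * g v ^ 4 + 0 * h v ^ 4 = 0" for v
      using fun_cong[OF fg(3), of v] by simp
    ultimately show False using no_three[of f g h 1 "- 1" 0] fg by auto
  qed
  obtain u where u: "\<exists>p\<in>(\<lambda>f. f ^ 4) ` S. u p \<noteq> 0" "(\<Sum>p\<in>(\<lambda>f. f ^ 4) ` S. fscale (u p) p) = 0"
    using dep forms.dependent_finite[of "(\<lambda>f. f ^ 4) ` S"] fin by auto
  define k where "k = (\<lambda>f. u (f ^ 4))"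
  have sum: "(\<Sum>f\<in>S. k f * f v ^ 4) = 0" for v
  proof -
    have "(\<Sum>f\<in>S. fscale (k f) (f ^ 4)) = 0"
      using u(2) unfolding sum.reindex[OF inj] k_def comp_def .
    moreover have "(\<Sum>f\<in>S. g f) v = (\<Sum>f\<in>S. g f v)" for g :: "form \<Rightarrow> form"
      using fin by (induction S) auto
    moreover from this have "(\<Sum>f\<in>S. k f * f v ^ 4) = (\<Sum>f\<in>S. fscale (k f) (f ^ 4)) v"
      by (simp add: fscale_def)
    ultimately show ?thesis by simp
  qed
  obtain f where f: "f \<in> S" "k f \<noteq> 0" using u(1) unfolding k_def by blast
  have knz: "k g \<noteq> 0" if g: "g \<in> S" for g
  proof
    assume kg: "k g = 0"
    have fg: "f \<noteq> g" using kg f by auto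
    have "card (S - {f, g}) = 2" using card f g fg fin by (simp add: card_Diff_subset)
    then obtain h i where hi: "S - {f, g} = {h, i}" "h \<noteq> i" by (auto simp: card_2_iff)
    then have S: "S = {g, f, h, i}" using f g by auto
    have m: "h \<in> S" "i \<in> S" "h \<noteq> f" "h \<noteq> g" "i \<noteq> f" "i \<noteq> g" using hi by auto
    have s: "k f * f v ^ 4 + (k h * h v ^ 4 + k i * i v ^ 4) = 0" for v
      using sum[of v] m fg hi(2) kg unfolding S by simp
    show False
    proof (cases "k h = 0")
      case False
      then show False
        using no_three[of f h i "k f" "k h" "k i"] s m f hi(2) by (auto simp: add.assoc)
    next
      case True
      show False
      proof (cases "k i = 0")
        case False
        then show False
          using no_three[of f i h "k f" "k i" "k h"] s m f hi(2) True by auto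
      next
        case ki: True
        have "f v = 0" for v using s[of v] f True ki by simp
        then show False using nz[OF f(1)] by (simp add: fun_eq_iff)
      qed
    qed
  qed
  have "card (S - {f}) = 3" using card f fin by simp
  then obtain f2 f3 f4 where "S - {f} = {f2, f3, f4}" and d: "f2 \<noteq> f3" "f2 \<noteq> f4" "f3 \<noteq> f4"
    by (auto simp: card_3_iff)
  then have S: "S = {f, f2, f3, f4}" and d': "f \<noteq> f2" "f \<noteq> f3" "f \<noteq> f4" using f by auto
  define r where "r = (\<lambda>g. csqrt (csqrt (k g)))"
  have r: "r g ^ 4 = k g" for g by (simp add: r_def csqrt_csqrt_power4)
  have rnz: "r g \<noteq> 0" if "g \<in> S" for g using r[of g] knz[OF that] by auto
  define F where "F = (\<lambda>g. fscale (r g) g)"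
  have q': "is_quadratic (F g)" if "g \<in> S" for g
    using is_quadratic_fscale[OF q[OF that]] by (simp add: F_def)
  have ind': "independent_pair (F g) (F h)" if "g \<in> S" "h \<in> S" "g \<noteq> h" for g h
    unfolding independent_pair_def
  proof (intro allI impI)
    fix c d assume "fscale c (F g) + fscale d (F h) = 0"
    then have "fscale (c * r g) g + fscale (d * r h) h = 0"
      unfolding F_def by (simp add: fscale_def mult.assoc)
    then have "c * r g = 0" "d * r h = 0"
      using ind[OF that] unfolding independent_pair_def by blast+
    then show "c = 0 \<and> d = 0" using rnz that by auto
  qed
  have "F f v ^ 4 + F f2 v ^ 4 + F f3 v ^ 4 + F f4 v ^ 4 = 0" for v
    using sum[of v] d d' unfolding S F_def by (simp add: fscale_def power_mult_distrib r add.assoc)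
  then have "first_kind {F f, F f2, F f3, F f4} \<or> second_kind {F f, F f2, F f3, F f4}"
    by (intro four_fourth_powers_classification) (use q' ind' d d' S in auto)
  moreover have "covered {F f, F f2, F f3, F f4} S"
  proof -
    have "proportional (F g) g" if "g \<in> S" for g
      using rnz[OF that] unfolding F_def
      by (intro proportionalI[of "1 / r g"]) (auto simp: fscale_def)
    then show ?thesis unfolding S by auto
  qed
  ultimately show ?thesis
    unfolding first_kind_def second_kind_def using covered_trans by meson
qed

section \<open>The classification\<close>

theorem theorem1p6:
  shows
   "(\<forall>S. W2_set 4 4 S \<longrightarrow>
       cousins {qform 1 0 1, qform \<omega> 0 (\<omega>\<^sup>2), qform (\<omega>\<^sup>2) 0 \<omega>, qform 0 1 0} S \<or>
       sub_cousin 4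
         (qform 1 sqrt3 (-1), fscale \<zeta> (qform 1 (- sqrt3) (-1)))
         (qform (\<omega>\<^sup>2) sqrt3 (- \<omega>), fscale \<zeta> (qform (\<omega>\<^sup>2) (- sqrt3) (- \<omega>)))
         (qform \<omega> sqrt3 (- (\<omega>\<^sup>2)), fscale \<zeta> (qform \<omega> (- sqrt3) (- (\<omega>\<^sup>2)))) S)
    \<and> (\<forall>x y. (x\<^sup>2 + y\<^sup>2) ^ 4 + (\<omega> * x\<^sup>2 + \<omega>\<^sup>2 * y\<^sup>2) ^ 4 + (\<omega>\<^sup>2 * x\<^sup>2 + \<omega> * y\<^sup>2) ^ 4
             = 18 * (x * y) ^ 4)
    \<and> (\<forall>x y. (x\<^sup>2 + sqrt3 * x * y - y\<^sup>2) ^ 4 - (x\<^sup>2 - sqrt3 * x * y - y\<^sup>2) ^ 4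
             = 8 * sqrt3 * x * y * (x ^ 6 - y ^ 6)
           \<and> (\<omega>\<^sup>2 * x\<^sup>2 + sqrt3 * x * y - \<omega> * y\<^sup>2) ^ 4 - (\<omega>\<^sup>2 * x\<^sup>2 - sqrt3 * x * y - \<omega> * y\<^sup>2) ^ 4
             = 8 * sqrt3 * x * y * (x ^ 6 - y ^ 6)
           \<and> (\<omega> * x\<^sup>2 + sqrt3 * x * y - \<omega>\<^sup>2 * y\<^sup>2) ^ 4 - (\<omega> * x\<^sup>2 - sqrt3 * x * y - \<omega>\<^sup>2 * y\<^sup>2) ^ 4
             = 8 * sqrt3 * x * y * (x ^ 6 - y ^ 6))"
proof (intro conjI allI impI)
  have id1: "(x\<^sup>2 + sqrt3 * x * y - y\<^sup>2) ^ 4 - (x\<^sup>2 - sqrt3 * x * y - y\<^sup>2) ^ 4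
    = 8 * sqrt3 * x * y * (x ^ 6 - y ^ 6)" for x y
    using difference_identity[of 1 1 sqrt3 x y] sqrt3_square by simp
  have w: "\<omega>\<^sup>2 * \<omega> = 1" "\<omega> * \<omega>\<^sup>2 = 1" "(\<omega>\<^sup>2) ^ 3 = 1"
    using omega_cube by algebra+
  have id2: "(\<omega>\<^sup>2 * x\<^sup>2 + sqrt3 * x * y - \<omega> * y\<^sup>2) ^ 4 - (\<omega>\<^sup>2 * x\<^sup>2 - sqrt3 * x * y - \<omega> * y\<^sup>2) ^ 4
    = 8 * sqrt3 * x * y * (x ^ 6 - y ^ 6)" for x y
    by (rule difference_identity[OF _ _ _ sqrt3_square]; fact w omega_cube)
  have id3: "(\<omega> * x\<^sup>2 + sqrt3 * x * y - \<omega>\<^sup>2 * y\<^sup>2) ^ 4 - (\<omega> * x\<^sup>2 - sqrt3 * x * y - \<omega>\<^sup>2 * y\<^sup>2) ^ 4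
    = 8 * sqrt3 * x * y * (x ^ 6 - y ^ 6)" for x y
    by (rule difference_identity[OF _ _ _ sqrt3_square]; fact w omega_cube)
  {
    fix x y
    show "(x\<^sup>2 + y\<^sup>2) ^ 4 + (\<omega> * x\<^sup>2 + \<omega>\<^sup>2 * y\<^sup>2) ^ 4 + (\<omega>\<^sup>2 * x\<^sup>2 + \<omega> * y\<^sup>2) ^ 4 = 18 * (x * y) ^ 4"
      using omega_square_sum by algebra
    show "(x\<^sup>2 + sqrt3 * x * y - y\<^sup>2) ^ 4 - (x\<^sup>2 - sqrt3 * x * y - y\<^sup>2) ^ 4
      = 8 * sqrt3 * x * y * (x ^ 6 - y ^ 6)" by (rule id1)
    show "(\<omega>\<^sup>2 * x\<^sup>2 + sqrt3 * x * y - \<omega> * y\<^sup>2) ^ 4 - (\<omega>\<^sup>2 * x\<^sup>2 - sqrt3 * x * y - \<omega> * y\<^sup>2) ^ 4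
      = 8 * sqrt3 * x * y * (x ^ 6 - y ^ 6)" by (rule id2)
    show "(\<omega> * x\<^sup>2 + sqrt3 * x * y - \<omega>\<^sup>2 * y\<^sup>2) ^ 4 - (\<omega> * x\<^sup>2 - sqrt3 * x * y - \<omega>\<^sup>2 * y\<^sup>2) ^ 4
      = 8 * sqrt3 * x * y * (x ^ 6 - y ^ 6)" by (rule id3)
  }
  fix S assume W: "W2_set 4 4 S"
  have S: "finite S" "card S = 4" "pairwise (\<lambda>f g. \<not> proportional f g) S"
    using W unfolding W2_set_def honest_def by auto
  have sums: "pair_pow_sum 4 (qform 1 sqrt3 (-1), fscale \<zeta> (qform 1 (- sqrt3) (-1)))
      = pair_pow_sum 4 (qform (\<omega>\<^sup>2) sqrt3 (- \<omega>), fscale \<zeta> (qform (\<omega>\<^sup>2) (- sqrt3) (- \<omega>)))"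
    "pair_pow_sum 4 (qform (\<omega>\<^sup>2) sqrt3 (- \<omega>), fscale \<zeta> (qform (\<omega>\<^sup>2) (- sqrt3) (- \<omega>)))
      = pair_pow_sum 4 (qform \<omega> sqrt3 (- (\<omega>\<^sup>2)), fscale \<zeta> (qform \<omega> (- sqrt3) (- (\<omega>\<^sup>2))))"
    \<comment> \<open>Because of \<open>\<zeta>\<^sup>4 = - 1\<close> these are the equalities between differences stated in the theorem.\<close>
    unfolding pair_pow_sum_zeta by (simp_all add: fun_eq_iff qform_apply id1 id2 id3)
  show "cousins {qform 1 0 1, qform \<omega> 0 (\<omega>\<^sup>2), qform (\<omega>\<^sup>2) 0 \<omega>, qform 0 1 0} S \<or>
       sub_cousin 4
         (qform 1 sqrt3 (-1), fscale \<zeta> (qform 1 (- sqrt3) (-1)))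
         (qform (\<omega>\<^sup>2) sqrt3 (- \<omega>), fscale \<zeta> (qform (\<omega>\<^sup>2) (- sqrt3) (- \<omega>)))
         (qform \<omega> sqrt3 (- (\<omega>\<^sup>2)), fscale \<zeta> (qform \<omega> (- sqrt3) (- (\<omega>\<^sup>2)))) S"
    using W2_set_first_or_second_kind[OF W]
  proof
    assume "first_kind S"
    then show ?thesis using first_kind_cousins[OF _ S(2,3)] by blast
  next
    assume "second_kind S"
    then show ?thesis
      using second_kind_cousins[OF _ S(2,3)] S(1,2) sums unfolding sub_cousin_def by blast
  qed
qed

end
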